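(* Let $0<\alpha<1$, let $\mathbf{x}=(x_1,\dots,x_N)\in\mathbb{R}^N$ be nonzero, let $s_{ij}$ ($1\le i\le N$, $1\le j\le M$) be i.i.d. $S(\alpha,1)$ random variables, and let $y_j=\sum_{i=1}^N x_is_{ij}$. Let $\epsilon>0$, $\theta=\left(\sum_{i=1}^N|x_i|^\alpha\right)^{1/\alpha}$ and $\psi=(\epsilon/\theta)^{\alpha/(1-\alpha)}$, and assume $\psi\le 1/3$. For each $i$ define the absolute minimum estimator $\hat x_{i,min}=y_t/s_{it}$, where $t=\arg\min_{1\le j\le M}|y_j/s_{ij}|$. Then for every coordinate $i$ with $x_i=0$, $$\Pr\left(|\hat x_{i,min}|>\epsilon\right)\le \frac{1}{(1+\psi)^M}.$$
   Context: A random variable $Z$ has the symmetric $\alpha$-stable distribution with unit scale, $S(\alpha,1)$, if its characteristic function is $E e^{\sqrt{-1}Zt}=e^{-|t|^\alpha}$. *)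

theory Defs
  imports "HOL-Probability.Probability"
begin

definition sym_stable :: "real \<Rightarrow> real measure \<Rightarrow> bool" where
  "sym_stable \<alpha> \<mu> \<longleftrightarrow> (\<forall>t. char \<mu> t = complex_of_real (exp (- (\<bar>t\<bar> powr \<alpha>))))"

definition meas :: "(nat \<Rightarrow> real) \<Rightarrow> (nat \<Rightarrow> nat \<Rightarrow> 'a \<Rightarrow> real) \<Rightarrow> nat \<Rightarrow> nat \<Rightarrow> 'a \<Rightarrow> real" where
  "meas x s N j \<omega> = (\<Sum>k<N. x k * s k j \<omega>)"

definition argmin_idx :: "(nat \<Rightarrow> real) \<Rightarrow> (nat \<Rightarrow> nat \<Rightarrow> 'a \<Rightarrow> real) \<Rightarrow> nat \<Rightarrow> nat \<Rightarrow> nat \<Rightarrow> 'a \<Rightarrow> nat" where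
  "argmin_idx x s N M i \<omega> =
     (LEAST j. j < M \<and> (\<forall>k<M. \<bar>meas x s N j \<omega> / s i j \<omega>\<bar> \<le> \<bar>meas x s N k \<omega> / s i k \<omega>\<bar>))"

definition xhat_min :: "(nat \<Rightarrow> real) \<Rightarrow> (nat \<Rightarrow> nat \<Rightarrow> 'a \<Rightarrow> real) \<Rightarrow> nat \<Rightarrow> nat \<Rightarrow> nat \<Rightarrow> 'a \<Rightarrow> real" where
  "xhat_min x s N M i \<omega> =
     (let t = argmin_idx x s N M i \<omega> in meas x s N t \<omega> / s i t \<omega>)"

end

theory Submission
  imports Defs "HOL-Complex_Analysis.Conformal_Mappings" "HOL-Real_Asymp.Real_Asymp"
begin

text \<open>
  Since \<open>x\<^sub>i = 0\<close>, the variables \<open>y\<^sub>j / \<theta>\<close> and \<open>s\<^sub>i\<^sub>j\<close> are independent \<open>S(\<alpha>,1)\<close> variables, and everything is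
  independent over \<open>j\<close>. So it suffices to show \<open>P(|S\<^sub>2| \<le> \<delta> |S\<^sub>1|) \<ge> \<psi> / (1 + \<psi>)\<close> for \<open>\<delta> = \<epsilon> / \<theta> \<le> 1\<close>.

  Put \<open>\<beta> = \<alpha>/2\<close>. Then \<open>S = (2A)\<^bsup>1/2\<^esup> G\<close> in law, with \<open>G\<close> standard normal and \<open>A\<close> positive \<open>\<beta>\<close>-stable, i.e.
  \<open>E exp (- \<lambda>A) = exp (- \<lambda>\<^bsup>\<beta>\<^esup>)\<close>. The ratio \<open>\<rho> = A\<^sub>2/A\<^sub>1\<close> satisfies \<open>E (y / (\<rho> + y)) = y\<^bsup>\<beta>\<^esup> / (1 + y\<^bsup>\<beta>\<^esup>)\<close>; by analytic
  continuation to \<open>-y\<close> this gives \<open>P(\<rho> \<le> y) \<ge> arg (1 + y\<^bsup>\<beta>\<^esup> e\<^bsup>i\<pi>\<beta>\<^esup>) / (\<pi>\<beta>)\<close>. Conditionally on \<open>k = (G\<^sub>1/G\<^sub>2)\<^sup>2\<close> the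
  event is \<open>\<rho> \<le> \<delta>\<^sup>2 k\<close>, and \<open>k\<close> has the same law as \<open>1/k\<close>. The claim follows from two inequalities for the
  angle \<open>\<Theta>(X) = arg (1 + X e\<^bsup>i\<pi>\<beta>\<^esup>)\<close>: \<open>\<Theta>(Xk) + \<Theta>(X/k) \<ge> 2 \<Theta>(X)\<close> for \<open>X \<le> 1\<close>, and
  \<open>\<Theta>(\<delta>\<^bsup>\<alpha>\<^esup>) \<ge> \<pi>\<beta> \<psi> / (1 + \<psi>)\<close>.
\<close>

subsection \<open>Two inequalities for angles\<close>

text \<open>Concavity of sine on [0, \<pi>]: up to \<pi>/2 its graph lies above the chord from the
  origin to (\<pi>/2, 1).\<close>

lemma sin_ge_chord:
  fixes y :: real
  assumes "0 \<le> y" "y \<le> pi / 2"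
  shows "2 * y / pi \<le> sin y"
proof -
  have conv: "convex_on {0..pi} (\<lambda>x. - sin x)"
    by (rule f''_ge0_imp_convex[where f' = "\<lambda>x. - cos x" and f'' = sin])
       (auto intro!: derivative_eq_intros sin_ge_zero)
  have "- sin ((1 - 2 * y / pi) *\<^sub>R 0 + (2 * y / pi) *\<^sub>R (pi / 2))
      \<le> (1 - 2 * y / pi) * - sin 0 + (2 * y / pi) * - sin (pi / 2)"
    using assms by (intro convex_onD[OF conv]) (auto simp: field_simps)
  then show ?thesis
    by simp
qed

text \<open>Equivalent to monotonicity of sin (c w) / w^q on (0, 1], where q = 1 - 2c/\<pi>. Its
  logarithmic derivative is nonnegative iff q sin y \<le> y cos y for y = c w. This follows from q
  \<le> 1 - 2y/\<pi>, from sin y \<le> y, and from the chord bound applied to cos y = sin (\<pi>/2 -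
  y).\<close>

lemma sin_powr_mono:
  fixes c u v :: real
  assumes c: "0 < c" "c < pi / 2" and uv: "0 < u" "u \<le> v" "v \<le> 1"
  shows "sin (c * u) * v powr (1 - 2 * c / pi) \<le> sin (c * v) * u powr (1 - 2 * c / pi)"
proof -
  define q where "q = 1 - 2 * c / pi"
  define h where "h w = ln (sin (c * w)) - q * ln w" for w
  have range: "0 < c * w" "c * w < pi / 2" "0 < sin (c * w)" if "u \<le> w" "w \<le> v" for w
  proof -
    show "0 < c * w" using that c uv by simp
    have "c * w \<le> c * 1" using that c uv by (intro mult_left_mono) auto
    then show "c * w < pi / 2" using c by linarith
    with \<open>0 < c * w\<close> show "0 < sin (c * w)" by (intro sin_gt_zero) auto
  qed
  have "h u \<le> h v"
  proof (rule DERIV_nonneg_imp_nondecreasing[OF uv(2)])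
    fix w assume w: "u \<le> w" "w \<le> v"
    define y where "y = c * w"
    note r = range[OF w, folded y_def]
    have w0: "0 < w" using w uv by simp
    have "q * sin y \<le> (1 - 2 * y / pi) * sin y"
      using w uv c r by (intro mult_right_mono) (auto simp: q_def y_def field_simps)
    also have "\<dots> \<le> (1 - 2 * y / pi) * y"
      using r by (intro mult_left_mono sin_x_le_x) (auto simp: field_simps)
    also have "1 - 2 * y / pi = 2 * (pi / 2 - y) / pi"
      by (simp add: field_simps)
    also have "\<dots> * y \<le> sin (pi / 2 - y) * y"
      using r by (intro mult_right_mono sin_ge_chord) auto
    also have "sin (pi / 2 - y) = cos y"
      by (simp add: sin_diff)
    finally have "q * sin y \<le> cos y * y" .
    then have nonneg: "0 \<le> c * cos y / sin y - q / w"
      using r w0 by (simp add: y_def field_simps)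
    have "(h has_real_derivative c * cos y / sin y - q / w) (at w)"
      unfolding h_def y_def using r w0
      by (auto intro!: derivative_eq_intros simp: y_def field_simps)
    with nonneg show "\<exists>d. (h has_real_derivative d) (at w) \<and> 0 \<le> d"
      by blast
  qed
  then have "ln (sin (c * u)) + q * ln v \<le> ln (sin (c * v)) + q * ln u"
    by (simp add: h_def)
  then have "ln (sin (c * u) * v powr q) \<le> ln (sin (c * v) * u powr q)"
    using range[of u] range[of v] uv by (simp add: ln_mult ln_powr)
  then show ?thesis
    using range[of u] range[of v] uv by (simp add: q_def)
qed

text \<open>The argument of \<open>1 + X e\<^bsup>ic\<^esup>\<close>, for \<open>0 < c < \<pi>/2\<close>.\<close>

definition sector_angle :: "real \<Rightarrow> real \<Rightarrow> real" where
  "sector_angle c X = arctan (X * sin c / (1 + X * cos c))"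

text \<open>Put v = t/(1 + t), so that X = (v/(1 - v))^q with q = 1 - 2c/\<pi>. Taking tangents and
  clearing denominators reduces the claim to sin (c v) \<le> X sin (c (1 - v)). This is
  \<open>sin_powr_mono\<close> for the pair v \<le> 1 - v, an ordering that t \<le> 1
  provides.\<close>

lemma sector_angle_ge:
  assumes c: "0 < c" "c < pi / 2" and t: "0 < t" "t \<le> 1"
  shows "c * (t / (1 + t)) \<le> sector_angle c (t powr (1 - 2 * c / pi))"
proof -
  define v where "v = t / (1 + t)"
  define X where "X = t powr (1 - 2 * c / pi)"
  have v: "0 < v" "v \<le> 1 - v" "v < 1" "1 - v \<le> 1" and tv: "t = v / (1 - v)"
    using t by (auto simp: v_def field_simps mult_le_one)
  have X: "X = v powr (1 - 2 * c / pi) / (1 - v) powr (1 - 2 * c / pi)" "0 < X"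
    using v by (auto simp: X_def tv powr_divide)
  have "sin (c * v) \<le> X * sin (c * (1 - v))"
    using sin_powr_mono[OF c v(1,2,4)] v
    by (simp add: X pos_le_divide_eq mult.commute)
  also have "sin (c * (1 - v)) = sin c * cos (c * v) - cos c * sin (c * v)"
    by (simp add: right_diff_distrib sin_diff)
  finally have *: "sin (c * v) * (1 + X * cos c) \<le> X * sin c * cos (c * v)"
    by (simp add: algebra_simps)
  have cv: "0 < c * v" "c * v < pi / 2"
  proof -
    have "c * v \<le> c * 1" using c v by (intro mult_left_mono) auto
    then show "c * v < pi / 2" using c by linarith
  qed (use c v in auto)
  have pos: "0 < cos (c * v)" "0 < 1 + X * cos c"
    using cv c X(2) by (auto intro!: cos_gt_zero_pi add_pos_pos mult_pos_pos)
  have "tan (c * v) \<le> X * sin c / (1 + X * cos c)"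
    using * pos by (simp add: tan_def field_simps)
  then have "arctan (tan (c * v)) \<le> sector_angle c X"
    unfolding sector_angle_def by (rule arctan_monotone')
  then show ?thesis
    using cv by (simp add: arctan_tan v_def X_def)
qed

lemma sector_angle_has_derivative:
  assumes c: "0 < c" "c < pi / 2" and "0 < X"
  shows "(sector_angle c has_real_derivative sin c / (1 + 2 * X * cos c + X\<^sup>2)) (at X)"
proof -
  have cs: "0 < cos c" using c by (intro cos_gt_zero_pi) auto
  then have pos: "0 < 1 + X * cos c" using assms by (intro add_pos_pos) auto
  have sq: "(1 + X * cos c)\<^sup>2 + (X * sin c)\<^sup>2 = 1 + 2 * X * cos c + X\<^sup>2"
    using sin_cos_squared_add[of c] by algebra
  have "(sector_angle c has_real_derivative
      inverse (1 + (X * sin c / (1 + X * cos c))\<^sup>2) *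
      ((sin c * (1 + X * cos c) - X * sin c * cos c) / ((1 + X * cos c) * (1 + X * cos c)))) (at X)"
    unfolding sector_angle_def[abs_def] using pos
    by (auto intro!: derivative_eq_intros)
  moreover have "1 + (X * sin c / (1 + X * cos c))\<^sup>2 = (1 + 2 * X * cos c + X\<^sup>2) / (1 + X * cos c)\<^sup>2"
    unfolding sq[symmetric] using pos by (simp add: power_divide add_divide_distrib)
  moreover have "sin c * (1 + X * cos c) - X * sin c * cos c = sin c"
    by (simp add: algebra_simps)
  ultimately show ?thesis
    using pos by (simp add: power2_eq_square)
qed

text \<open>The right side is invariant under replacing k by 1/k, so k \<ge> 1 may be assumed. There
  it is nondecreasing in k and starts from the left side at k = 1: the two terms of its derivative
  compare through (k^2 - 1)(1 - X^2) \<ge> 0.\<close>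

lemma sector_angle_scale_ge:
  assumes c: "0 < c" "c < pi / 2" and X: "0 < X" "X \<le> 1" and k: "0 < k"
  shows "2 * sector_angle c X \<le> sector_angle c (X * k) + sector_angle c (X / k)"
proof -
  have *: "2 * sector_angle c X \<le> sector_angle c (X * k) + sector_angle c (X / k)" if "1 \<le> k" for k
  proof -
    let ?F = "\<lambda>k. sector_angle c (X * k) + sector_angle c (X / k)"
    let ?D = "\<lambda>Y. sin c / (1 + 2 * Y * cos c + Y\<^sup>2)"
    have cs: "0 < cos c" "0 < sin c" using c by (auto intro!: cos_gt_zero_pi sin_gt_zero)
    have "?F 1 \<le> ?F k"
    proof (rule DERIV_nonneg_imp_nondecreasing[OF that])
      fix w assume w: "1 \<le> w" "w \<le> k"
      have d1: "((\<lambda>k. sector_angle c (X * k)) has_real_derivative ?D (X * w) * X) (at w)"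
        by (rule DERIV_chain2[OF sector_angle_has_derivative[OF c]])
           (use X w in \<open>auto intro!: derivative_eq_intros\<close>)
      have d2: "((\<lambda>k. sector_angle c (X / k)) has_real_derivative ?D (X / w) * (- X / w\<^sup>2)) (at w)"
        by (rule DERIV_chain2[OF sector_angle_has_derivative[OF c]])
           (use X w in \<open>auto intro!: derivative_eq_intros simp: power2_eq_square\<close>)
      have e1: "?D (X / w) / w\<^sup>2 = sin c / (w\<^sup>2 + 2 * X * w * cos c + X\<^sup>2)"
      proof -
        have "(1 + 2 * (X / w) * cos c + (X / w)\<^sup>2) * w\<^sup>2 = w\<^sup>2 + 2 * X * w * cos c + X\<^sup>2"
          using w by (simp add: field_simps power2_eq_square)
        then show ?thesis by (simp only: divide_divide_eq_left)
      qed
      have e2: "sin c / (w\<^sup>2 + 2 * X * w * cos c + X\<^sup>2) \<le> ?D (X * w)"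
      proof (rule divide_left_mono)
        have "0 \<le> (w\<^sup>2 - 1) * (1 - X\<^sup>2)"
          using X w by (intro mult_nonneg_nonneg) (auto simp: power_le_one)
        then show "1 + 2 * (X * w) * cos c + (X * w)\<^sup>2 \<le> w\<^sup>2 + 2 * X * w * cos c + X\<^sup>2"
          by (simp add: algebra_simps power_mult_distrib)
        show "0 < (w\<^sup>2 + 2 * X * w * cos c + X\<^sup>2) * (1 + 2 * (X * w) * cos c + (X * w)\<^sup>2)"
          using X w cs by (intro mult_pos_pos add_pos_pos) auto
      qed (use cs in auto)
      have "0 \<le> X * (?D (X * w) - ?D (X / w) / w\<^sup>2)"
        using X ord_eq_le_trans[OF e1 e2] by simp
      also have "\<dots> = ?D (X * w) * X + ?D (X / w) * (- X / w\<^sup>2)"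
        by (simp add: algebra_simps)
      finally show "\<exists>y. (?F has_real_derivative y) (at w) \<and> 0 \<le> y"
        using DERIV_add[OF d1 d2] by blast
    qed
    then show ?thesis by simp
  qed
  show ?thesis
  proof (cases "1 \<le> k")
    case False
    with k have "1 \<le> 1 / k" by simp
    from *[OF this] show ?thesis by simp
  qed (rule *)
qed

subsection \<open>Stieltjes inversion\<close>

text \<open>Differentiation under the integral sign. On the convex set S the mean value inequality
  bounds every difference quotient by K, a constant that is integrable for a finite measure, so
  dominated convergence applies along each sequence tending to z. The general field covers both the
  complex logarithm and the real Laplace transform below.\<close>

lemma (in finite_measure) has_field_derivative_integral:
  fixes f :: "'b::{real_normed_field,banach,second_countable_topology} \<Rightarrow> 'a \<Rightarrow> 'b"
  assumes S: "open S" "convex S" "z \<in> S"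
    and int: "\<And>w. w \<in> S \<Longrightarrow> integrable M (f w)"
    and meas: "f' z \<in> borel_measurable M"
    and der: "\<And>w x. w \<in> S \<Longrightarrow> x \<in> space M \<Longrightarrow> ((\<lambda>w. f w x) has_field_derivative f' w x) (at w)"
    and bound: "\<And>w x. w \<in> S \<Longrightarrow> x \<in> space M \<Longrightarrow> norm (f' w x) \<le> K"
  shows "((\<lambda>w. \<integral>x. f w x \<partial>M) has_field_derivative (\<integral>x. f' z x \<partial>M)) (at z)"
proof -
  note [measurable] = meas
  have "((\<lambda>w. ((\<integral>x. f w x \<partial>M) - (\<integral>x. f z x \<partial>M)) / (w - z)) \<longlongrightarrow> (\<integral>x. f' z x \<partial>M)) (at z within S)"
    unfolding tendsto_at_iff_sequentially
  proof (intro allI impI)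
    fix X assume X: "\<forall>i. X i \<in> S - {z}" "X \<longlonglongrightarrow> z"
    have XS: "X i \<in> S" "X i \<noteq> z" for i using X by auto
    have lim: "(\<lambda>i. \<integral>x. (f (X i) x - f z x) / (X i - z) \<partial>M) \<longlonglongrightarrow> (\<integral>x. f' z x \<partial>M)"
    proof (rule integral_dominated_convergence[where w = "\<lambda>_. K"])
      show "(\<lambda>x. (f (X i) x - f z x) / (X i - z)) \<in> borel_measurable M" for i
        using int[OF XS(1)[of i]] int[OF S(3)] by measurable
      show "AE x in M. (\<lambda>i. (f (X i) x - f z x) / (X i - z)) \<longlonglongrightarrow> f' z x"
      proof (rule AE_I2)
        fix x assume "x \<in> space M"
        from der[OF S(3) this] have "((\<lambda>w. (f w x - f z x) / (w - z)) \<longlongrightarrow> f' z x) (at z)"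
          by (simp add: has_field_derivative_iff)
        then show "(\<lambda>i. (f (X i) x - f z x) / (X i - z)) \<longlonglongrightarrow> f' z x"
          unfolding tendsto_at_iff_sequentially comp_def using X by auto
      qed
      show "AE x in M. norm ((f (X i) x - f z x) / (X i - z)) \<le> K" for i
      proof (rule AE_I2)
        fix x assume x: "x \<in> space M"
        have "norm (f (X i) x - f z x) \<le> K * norm (X i - z)"
          by (rule field_differentiable_bound[OF S(2)])
             (use S x XS in \<open>auto intro!: der[THEN has_field_derivative_at_within] bound\<close>)
        then show "norm ((f (X i) x - f z x) / (X i - z)) \<le> K"
          using XS(2)[of i] by (simp add: norm_divide field_simps)
      qed
    qed auto
    have eq: "(\<integral>x. (f (X i) x - f z x) / (X i - z) \<partial>M)
        = ((\<integral>x. f (X i) x \<partial>M) - (\<integral>x. f z x \<partial>M)) / (X i - z)" for i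
      using int[OF XS(1)[of i]] int[OF S(3)] by simp
    show "((\<lambda>w. ((\<integral>x. f w x \<partial>M) - (\<integral>x. f z x \<partial>M)) / (w - z)) \<circ> X) \<longlonglongrightarrow> (\<integral>x. f' z x \<partial>M)"
      using lim unfolding comp_def eq .
  qed
  then show ?thesis
    unfolding has_field_derivative_iff at_within_open[OF S(3,1)] .
qed

text \<open>Rotating by half the argument of \<open>exp w\<close> makes both summands point into the right half-plane.\<close>
lemma norm_add_exp_ge:
  assumes "0 \<le> r" "\<bar>Im w\<bar> < pi"
  shows "norm (exp w) * cos (Im w / 2) \<le> norm (complex_of_real r + exp w)"
proof -
  define h where "h = Im w / 2"
  have c: "0 \<le> cos h" using assms by (intro cos_ge_zero) (auto simp: h_def)
  have e: "exp w = of_real (exp (Re w)) * cis (2 * h)"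
    by (simp add: h_def exp_eq_polar)
  have "(of_real r + exp w) * cis (- h) = of_real r * cis (- h) + of_real (exp (Re w)) * cis h"
    unfolding e by (simp add: distrib_right cis_mult mult.assoc)
  then have "Re ((of_real r + exp w) * cis (- h)) = (r + exp (Re w)) * cos h"
    by (simp add: algebra_simps)
  moreover have "Re ((of_real r + exp w) * cis (- h)) \<le> norm ((of_real r + exp w) * cis (- h))"
    by (rule complex_Re_le_cmod)
  ultimately have "(r + exp (Re w)) * cos h \<le> norm (of_real r + exp w)"
    by (simp add: norm_mult)
  moreover have "exp (Re w) * cos h \<le> (r + exp (Re w)) * cos h"
    using assms c by (intro mult_right_mono) auto
  ultimately show ?thesis
    by (simp add: h_def)
qed

text \<open>A vanishing imaginary part forces Im w = 0 in the strip, and then the sum is positive.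
  This keeps the arguments of \<open>Ln\<close> off its branch cut.\<close>

lemma add_exp_not_nonpos:
  assumes "0 \<le> r" "\<bar>Im w\<bar> < pi"
  shows "complex_of_real r + exp w \<notin> \<real>\<^sub>\<le>\<^sub>0"
proof
  assume *: "complex_of_real r + exp w \<in> \<real>\<^sub>\<le>\<^sub>0"
  then have "sin (Im w) = 0"
    by (auto simp: complex_nonpos_Reals_iff Im_exp)
  with assms(2) have "Im w = 0"
    using sin_zero_pi_iff by blast
  with * have "r + exp (Re w) \<le> 0"
    by (auto simp: complex_nonpos_Reals_iff Re_exp)
  with assms(1) exp_gt_zero[of "Re w"] show False
    by linarith
qed

lemma has_field_derivative_Ln_compose:
  assumes "(g has_field_derivative g') (at z)" "g z \<notin> \<real>\<^sub>\<le>\<^sub>0"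
  shows "((\<lambda>z. Ln (g z)) has_field_derivative g' / g z) (at z)"
  using DERIV_chain2[OF has_field_derivative_Ln[OF assms(2)] assms(1)]
  by (simp add: divide_inverse mult.commute)

section \<open>The logarithmic transform on a horizontal strip\<close>

lemma open_strip: "open {w. \<bar>Im w\<bar> < a}"
  by (intro open_Collect_less continuous_intros)

lemma convex_strip: "convex {w. \<bar>Im w\<bar> < a}"
proof -
  have "{w. \<bar>Im w\<bar> < a} = Im -` {-a<..<a}" by auto
  also have "convex \<dots>"
    by (intro convex_linear_vimage) (auto intro: bounded_linear.linear bounded_linear_Im)
  finally show ?thesis .
qed

text \<open>The substitution z = exp w turns the slit plane into a strip. Subtracting Ln (r + 1)
  makes the integrand vanish at w = 0, so the bound on its derivative already makes it integrable,
  without a moment condition on r.\<close>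

lemma (in prob_space) log_transform_has_derivative:
  assumes [measurable]: "r \<in> borel_measurable M" and r: "\<And>x. x \<in> space M \<Longrightarrow> 0 \<le> r x"
    and w: "\<bar>Im w\<bar> < pi"
  shows "integrable M (\<lambda>x. Ln (of_real (r x) + exp w) - Ln (of_real (r x + 1)))"
    and "((\<lambda>w. \<integral>x. Ln (of_real (r x) + exp w) - Ln (of_real (r x + 1)) \<partial>M)
           has_field_derivative (\<integral>x. exp w / (of_real (r x) + exp w) \<partial>M)) (at w)"
proof -
  define f where "f w x = Ln (of_real (r x) + exp w) - Ln (of_real (r x + 1))"
    for w :: complex and x
  define f' where "f' w x = exp w / (of_real (r x) + exp w)" for w :: complex and x
  \<comment> \<open>The derivative bound 1 / cos (a/2) degenerates as a tends to \<pi>, hence a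
    strictly narrower strip that still contains w.\<close>
  obtain a where a: "\<bar>Im w\<bar> < a" "a < pi" using dense[OF w] by blast
  let ?S = "{w. \<bar>Im w\<bar> < a}"
  have der: "((\<lambda>w. f w x) has_field_derivative f' w x) (at w)" if "w \<in> ?S" "x \<in> space M" for w x
  proof -
    have "((\<lambda>w. complex_of_real (r x) + exp w) has_field_derivative exp w) (at w)"
      by (auto intro!: derivative_eq_intros)
    then have "((\<lambda>w. Ln (of_real (r x) + exp w)) has_field_derivative f' w x) (at w)"
      unfolding f'_def using that a r[of x]
      by (intro has_field_derivative_Ln_compose add_exp_not_nonpos) auto
    from DERIV_diff[OF this DERIV_const] show ?thesis
      by (simp add: f_def)
  qed
  have bound: "norm (f' w x) \<le> 1 / cos (a / 2)" if "w \<in> ?S" "x \<in> space M" for w x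
  proof -
    have c: "0 < cos (a / 2)" "cos (a / 2) \<le> cos (Im w / 2)"
    proof -
      show "0 < cos (a / 2)" using that a by (intro cos_gt_zero_pi) auto
      have "cos (a / 2) \<le> cos (\<bar>Im w / 2\<bar>)"
        using that a by (intro cos_monotone_0_pi_le) auto
      then show "cos (a / 2) \<le> cos (Im w / 2)" by (simp add: abs_if split: if_splits)
    qed
    have "norm (exp w) * cos (a / 2) \<le> norm (exp w) * cos (Im w / 2)"
      using c by (intro mult_left_mono) auto
    also have "\<dots> \<le> norm (of_real (r x) + exp w)"
      using that a r by (intro norm_add_exp_ge) auto
    finally have *: "norm (exp w) * cos (a / 2) \<le> norm (of_real (r x) + exp w)" .
    moreover have "0 < norm (exp w) * cos (a / 2)" using c by simp
    ultimately have "0 < norm (of_real (r x) + exp w)" by linarith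
    with * c show ?thesis
      by (simp add: f'_def norm_divide field_simps)
  qed
  have int: "integrable M (f w)" if "w \<in> ?S" for w
  proof (rule integrable_const_bound[where B = "1 / cos (a / 2) * norm w"])
    show "f w \<in> borel_measurable M" unfolding f_def by measurable
    show "AE x in M. norm (f w x) \<le> 1 / cos (a / 2) * norm w"
    proof (rule AE_I2)
      fix x assume x: "x \<in> space M"
      have 0: "f 0 x = 0" by (simp add: f_def)
      have "norm (f w x - f 0 x) \<le> 1 / cos (a / 2) * norm (w - 0)"
        by (rule field_differentiable_bound[OF convex_strip[of a]])
           (use x that a in \<open>auto intro!: der[THEN has_field_derivative_at_within] bound\<close>)
      then show "norm (f w x) \<le> 1 / cos (a / 2) * norm w" by (simp add: 0)
    qed
  qed
  show "integrable M (\<lambda>x. Ln (of_real (r x) + exp w) - Ln (of_real (r x + 1)))"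
    using int[of w] a unfolding f_def[abs_def] by blast
  have "f' w \<in> borel_measurable M" unfolding f'_def by measurable
  moreover have "w \<in> ?S" using a by simp
  ultimately have "((\<lambda>w. \<integral>x. f w x \<partial>M) has_field_derivative (\<integral>x. f' w x \<partial>M)) (at w)"
    using has_field_derivative_integral[OF open_strip convex_strip _ int _ der bound] by blast
  then show "((\<lambda>w. \<integral>x. Ln (of_real (r x) + exp w) - Ln (of_real (r x + 1)) \<partial>M)
           has_field_derivative (\<integral>x. exp w / (of_real (r x) + exp w) \<partial>M)) (at w)"
    unfolding f_def f'_def .
qed

text \<open>At real w = s the derivatives of both sides agree: this is \<open>stieltjes\<close> at y
  = exp s. By the identity theorem they agree on the whole strip, so the two sides differ by a
  constant, and the constant is 0 because both vanish at w = 0.\<close>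

lemma (in prob_space) log_transform_eq:
  assumes \<beta>: "0 < \<beta>" "\<beta> < 1"
    and [measurable]: "r \<in> borel_measurable M" and r: "\<And>x. x \<in> space M \<Longrightarrow> 0 \<le> r x"
    and stieltjes: "\<And>y. 0 < y \<Longrightarrow> expectation (\<lambda>x. y / (r x + y)) = y powr \<beta> / (1 + y powr \<beta>)"
    and w: "\<bar>Im w\<bar> < pi"
  shows "(\<integral>x. Ln (of_real (r x) + exp w) - Ln (of_real (r x + 1)) \<partial>M)
    = (Ln (1 + exp (of_real \<beta> * w)) - Ln 2) / of_real \<beta>"
proof -
  let ?S = "{w. \<bar>Im w\<bar> < pi}"
  define \<Psi> where "\<Psi> w = (\<integral>x. Ln (of_real (r x) + exp w) - Ln (of_real (r x + 1)) \<partial>M)" for w :: complex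
  define \<Delta> where "\<Delta> w = \<Psi> w - Ln (1 + exp (of_real \<beta> * w)) / of_real \<beta>" for w
  define \<Delta>' where "\<Delta>' w = (\<integral>x. exp w / (of_real (r x) + exp w) \<partial>M)
    - exp (of_real \<beta> * w) / (1 + exp (of_real \<beta> * w))" for w :: complex
  have der: "(\<Delta> has_field_derivative \<Delta>' w) (at w)" if "w \<in> ?S" for w
  proof -
    have "\<bar>Im (of_real \<beta> * w)\<bar> = \<beta> * \<bar>Im w\<bar>" using \<beta> by (simp add: abs_mult)
    also have "\<dots> \<le> 1 * \<bar>Im w\<bar>" using \<beta> by (intro mult_right_mono) auto
    also have "\<dots> < pi" using that by simp
    finally have "1 + exp (of_real \<beta> * w) \<notin> \<real>\<^sub>\<le>\<^sub>0"
      using add_exp_not_nonpos[of 1 "of_real \<beta> * w"] by simp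
    moreover have "((\<lambda>w. 1 + exp (of_real \<beta> * w)) has_field_derivative exp (of_real \<beta> * w) * of_real \<beta>) (at w)"
      by (auto intro!: derivative_eq_intros)
    ultimately have "((\<lambda>w. Ln (1 + exp (of_real \<beta> * w))) has_field_derivative
        exp (of_real \<beta> * w) * of_real \<beta> / (1 + exp (of_real \<beta> * w))) (at w)"
      by (intro has_field_derivative_Ln_compose)
    from DERIV_cdivide[OF this, of "of_real \<beta>"] have "((\<lambda>w. Ln (1 + exp (of_real \<beta> * w)) / of_real \<beta>) has_field_derivative
        exp (of_real \<beta> * w) / (1 + exp (of_real \<beta> * w))) (at w)"
      using \<beta> by simp
    moreover have "(\<Psi> has_field_derivative (\<integral>x. exp w / (of_real (r x) + exp w) \<partial>M)) (at w)"
      unfolding \<Psi>_def using that r by (intro log_transform_has_derivative) auto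
    ultimately show ?thesis
      unfolding \<Delta>_def \<Delta>'_def by (intro DERIV_diff)
  qed
  have hol: "deriv \<Delta> holomorphic_on ?S"
    using der by (intro holomorphic_deriv open_strip) (auto simp: holomorphic_on_open[OF open_strip])
  have real0: "deriv \<Delta> z = 0" if zr: "z \<in> range complex_of_real" for z
  proof -
    obtain s where z: "z = of_real s" using zr by blast
    have "(\<integral>x. exp z / (of_real (r x) + exp z) \<partial>M)
        = (\<integral>x. complex_of_real (exp s / (r x + exp s)) \<partial>M)"
      by (simp add: z flip: exp_of_real)
    also have "\<dots> = of_real (\<integral>x. exp s / (r x + exp s) \<partial>M)"
      by (rule integral_complex_of_real)
    also have "\<dots> = of_real (exp (\<beta> * s) / (1 + exp (\<beta> * s)))"
      by (subst stieltjes) (simp_all add: powr_def)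
    also have "\<dots> = exp (of_real \<beta> * z) / (1 + exp (of_real \<beta> * z))"
      by (simp add: z flip: exp_of_real)
    finally have "\<Delta>' z = 0" by (simp add: \<Delta>'_def)
    moreover have "z \<in> ?S" by (simp add: z)
    ultimately show ?thesis using DERIV_imp_deriv[OF der] by metis
  qed
  have lim: "0 islimpt range complex_of_real"
    unfolding islimpt_approachable
  proof (intro allI impI)
    fix e :: real assume "0 < e"
    then have "complex_of_real (e / 2) \<noteq> 0 \<and> dist (complex_of_real (e / 2)) 0 < e"
      by (auto simp: dist_norm norm_divide)
    then show "\<exists>x'\<in>range complex_of_real. x' \<noteq> 0 \<and> dist x' 0 < e"
      by blast
  qed
  have deriv0: "deriv \<Delta> z = 0" if "z \<in> ?S" for z
    by (rule analytic_continuation[OF hol open_strip convex_connected[OF convex_strip] _ _ lim real0])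
       (use that in auto)
  have "(\<Delta> has_field_derivative 0) (at z within ?S)" if "z \<in> ?S" for z
    using der[OF that] deriv0[OF that] DERIV_imp_deriv has_field_derivative_at_within by metis
  then obtain c where c: "\<And>z. z \<in> ?S \<Longrightarrow> \<Delta> z = c"
    using has_field_derivative_zero_constant[OF convex_strip[of pi], of \<Delta>] by blast
  have "\<Delta> w = \<Delta> 0" using c[of w] c[of 0] w by simp
  moreover have "\<Psi> 0 = 0" by (simp add: \<Psi>_def)
  ultimately show ?thesis
    by (simp add: \<Delta>_def \<Psi>_def diff_divide_distrib algebra_simps)
qed

text \<open>Stieltjes inversion: as \<open>\<phi> \<rightarrow> \<pi>\<close>, the argument of \<open>r + x e\<^bsup>i\<phi>\<^esup>\<close> tends to \<open>0\<close> where \<open>x < r\<close>,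
  and it is at most \<open>\<pi>\<close> elsewhere.\<close>
lemma (in prob_space) stieltjes_cdf_ge:
  assumes \<beta>: "0 < \<beta>" "\<beta> < 1"
    and [measurable]: "r \<in> borel_measurable M" and r: "\<And>x. x \<in> space M \<Longrightarrow> 0 \<le> r x"
    and stieltjes: "\<And>y. 0 < y \<Longrightarrow> expectation (\<lambda>x. y / (r x + y)) = y powr \<beta> / (1 + y powr \<beta>)"
    and y: "0 < y"
  shows "Im (Ln (1 + of_real (y powr \<beta>) * cis (\<beta> * pi))) \<le> \<beta> * pi * prob {x \<in> space M. r x \<le> y}"
proof -
  \<comment> \<open>Angles tending to \<pi> from inside the strip where
    \<open>log_transform_eq\<close> holds. The offset 2 makes \<open>\<phi> 0\<close> equal to
    \<pi>/2 and hence positive.\<close>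
  define \<phi> where "\<phi> n = pi - pi / real (n + 2)" for n
  have \<phi>: "0 < \<phi> n" "\<phi> n < pi" for n
  proof -
    have "pi * 1 < pi * real (n + 2)" by (intro mult_strict_left_mono) auto
    then have "pi / real (n + 2) < pi" by (simp only: divide_less_eq) simp
    then show "0 < \<phi> n" "\<phi> n < pi" by (simp_all add: \<phi>_def del: of_nat_add)
  qed
  have lim\<phi>: "\<phi> \<longlonglongrightarrow> pi"
  proof -
    have "(\<lambda>n. pi - pi / real (n + 2)) \<longlonglongrightarrow> pi - 0"
      by (intro tendsto_intros LIMSEQ_ignore_initial_segment lim_const_over_n)
    then show ?thesis by (simp add: \<phi>_def[abs_def])
  qed
  define w where "w n = Complex (ln y) (\<phi> n)" for n
  have w: "\<bar>Im (w n)\<bar> < pi" for n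
    using \<phi>[of n] by (simp add: w_def)
  have expw: "exp (w n) = of_real y * cis (\<phi> n)" for n
    using y by (simp add: w_def exp_eq_polar)
  have expbw: "exp (of_real \<beta> * w n) = of_real (y powr \<beta>) * cis (\<beta> * \<phi> n)" for n
    using y by (simp add: w_def exp_eq_polar powr_def)
  define g where "g n x = Im (Ln (of_real (r x) + exp (w n)))" for n x
  have [measurable]: "g n \<in> borel_measurable M" for n
    unfolding g_def by measurable
  have g_le: "\<bar>g n x\<bar> \<le> pi" if "x \<in> space M" for n x
  proof -
    have "of_real (r x) + exp (w n) \<noteq> 0"
      using add_exp_not_nonpos[OF r[OF that] w[of n]] by auto
    then show ?thesis
      using Im_Ln_le_pi mpi_less_Im_Ln by (fastforce simp: g_def abs_le_iff)
  qed
  have g_int: "integrable M (g n)" for n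
    by (rule integrable_const_bound[where B = pi]) (auto intro!: AE_I2 g_le)
  \<comment> \<open>The imaginary part of \<open>log_transform_eq\<close>: the normalising terms Ln
    (r + 1) and Ln 2 are real and drop out.\<close>
  have Eg: "expectation (g n) = Im (Ln (1 + of_real (y powr \<beta>) * cis (\<beta> * \<phi> n))) / \<beta>" for n
  proof -
    have "g n x = Im (Ln (of_real (r x) + exp (w n)) - Ln (of_real (r x + 1)))" if "x \<in> space M" for x
      using r[OF that] by (simp add: g_def Ln_of_real del: of_real_add)
    then have "expectation (g n) = (\<integral>x. Im (Ln (of_real (r x) + exp (w n)) - Ln (of_real (r x + 1))) \<partial>M)"
      by (intro Bochner_Integration.integral_cong) auto
    also have "\<dots> = Im (\<integral>x. Ln (of_real (r x) + exp (w n)) - Ln (of_real (r x + 1)) \<partial>M)"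
      using log_transform_has_derivative(1)[OF _ r w[of n]] by (intro integral_Im) auto
    also have "\<dots> = Im ((Ln (1 + exp (of_real \<beta> * w n)) - Ln 2) / of_real \<beta>)"
      using log_transform_eq[OF \<beta> _ r stieltjes w[of n]] by simp
    also have "\<dots> = Im (Ln (1 + exp (of_real \<beta> * w n))) / \<beta>"
      using Ln_of_real[of 2] by (simp add: Im_divide_of_real)
    finally show ?thesis by (simp add: expbw)
  qed
  define tail where "tail n x = indicator {x. y < r x} x * g n x" for n x
  have [measurable]: "tail n \<in> borel_measurable M" for n
    unfolding tail_def by measurable
  have tail_int: "integrable M (tail n)" for n
    by (rule integrable_const_bound[where B = pi])
       (auto intro!: AE_I2 g_le simp: tail_def indicator_def)
  have "(\<lambda>n. expectation (tail n)) \<longlonglongrightarrow> expectation (\<lambda>x. 0)"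
  proof (rule integral_dominated_convergence[where w = "\<lambda>_. pi"])
    show "AE x in M. (\<lambda>n. tail n x) \<longlonglongrightarrow> 0"
    proof (rule AE_I2)
      fix x assume x: "x \<in> space M"
      show "(\<lambda>n. tail n x) \<longlonglongrightarrow> 0"
      proof (cases "y < r x")
        case True
        have "(\<lambda>n. of_real (r x) + of_real y * cis (\<phi> n)) \<longlonglongrightarrow> of_real (r x) + of_real y * cis pi"
          by (intro tendsto_intros lim\<phi>)
        also have "of_real (r x) + of_real y * cis pi = complex_of_real (r x - y)"
          by (simp add: cis_pi)
        finally have "(\<lambda>n. Im (Ln (of_real (r x) + of_real y * cis (\<phi> n)))) \<longlonglongrightarrow> Im (Ln (complex_of_real (r x - y)))"
          by (rule tendsto_Im[OF tendsto_Ln]) (use True in \<open>auto simp: complex_nonpos_Reals_iff\<close>)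
        also have "Im (Ln (complex_of_real (r x - y))) = 0"
          using True by (subst Ln_of_real) auto
        finally show ?thesis using True by (simp add: tail_def g_def expw)
      qed (simp add: tail_def)
    qed
    show "AE x in M. norm (tail n x) \<le> pi" for n
      by (auto intro!: AE_I2 g_le simp: tail_def indicator_def)
  qed auto
  then have lim_tail: "(\<lambda>n. expectation (tail n)) \<longlonglongrightarrow> 0" by simp
  have le: "Im (Ln (1 + of_real (y powr \<beta>) * cis (\<beta> * \<phi> n))) / \<beta>
      \<le> pi * prob {x \<in> space M. r x \<le> y} + expectation (tail n)" for n
  proof -
    have ind: "integrable M (\<lambda>x. pi * indicator {x \<in> space M. r x \<le> y} x)"
      by (intro integrable_mult_right integrable_real_indicator) (auto simp: emeasure_eq_measure)
    have "expectation (g n) \<le> expectation (\<lambda>x. pi * indicator {x \<in> space M. r x \<le> y} x + tail n x)"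
    proof (rule integral_mono[OF g_int Bochner_Integration.integrable_add[OF ind tail_int]])
      show "g n x \<le> pi * indicator {x \<in> space M. r x \<le> y} x + tail n x" if "x \<in> space M" for x
        using g_le[OF that, of n] that by (auto simp: tail_def indicator_def)
    qed
    also have "\<dots> = pi * prob {x \<in> space M. r x \<le> y} + expectation (tail n)"
      by (subst Bochner_Integration.integral_add[OF ind tail_int]) simp
    finally show ?thesis by (simp add: Eg)
  qed
  have bp: "\<beta> * pi < pi" "0 < \<beta> * pi" using \<beta> by auto
  have "(\<lambda>n. Im (Ln (1 + of_real (y powr \<beta>) * cis (\<beta> * \<phi> n))) / \<beta>)
      \<longlonglongrightarrow> Im (Ln (1 + of_real (y powr \<beta>) * cis (\<beta> * pi))) / \<beta>"
  proof (intro tendsto_intros lim\<phi>)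
    show "1 + of_real (y powr \<beta>) * cis (\<beta> * pi) \<notin> \<real>\<^sub>\<le>\<^sub>0"
      using sin_gt_zero[OF bp(2,1)] y by (auto simp: complex_nonpos_Reals_iff)
  qed (use \<beta> in auto)
  moreover have "(\<lambda>n. pi * prob {x \<in> space M. r x \<le> y} + expectation (tail n))
      \<longlonglongrightarrow> pi * prob {x \<in> space M. r x \<le> y} + 0"
    by (intro tendsto_intros lim_tail)
  ultimately have "Im (Ln (1 + of_real (y powr \<beta>) * cis (\<beta> * pi))) / \<beta>
      \<le> pi * prob {x \<in> space M. r x \<le> y} + 0"
    by (rule LIMSEQ_le) (use le in auto)
  then show ?thesis
    using \<beta> by (simp add: field_simps)
qed

subsection \<open>Existence of positive stable laws\<close>

text \<open>If \<open>U\<close> is uniform, then \<open>n (1 - E exp (- \<mu> (n U)\<^bsup>-1/\<beta>\<^esup>))\<close> is the integral of this kernel over \<open>{0..n}\<close>,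
  which tends to a multiple of \<open>\<mu>\<^bsup>\<beta>\<^esup>\<close>. Hence sums of \<open>n\<close> such Pareto variables approach a positive stable law.\<close>

definition pareto_kernel :: "real \<Rightarrow> real \<Rightarrow> real \<Rightarrow> real" where
  "pareto_kernel \<beta> \<mu> v = (1 - exp (- (\<mu> * v powr (- 1 / \<beta>)))) * indicator {0<..} v"

lemma pareto_kernel_measurable [measurable]: "pareto_kernel \<beta> \<mu> \<in> borel_measurable borel"
  unfolding pareto_kernel_def by measurable

lemma pareto_kernel_bounds:
  assumes "0 \<le> \<mu>"
  shows "0 \<le> pareto_kernel \<beta> \<mu> v" "pareto_kernel \<beta> \<mu> v \<le> 1"
  using assms by (auto simp: pareto_kernel_def indicator_def)

lemma integrable_powr_tail:
  assumes "1 < p"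
  shows "integrable lborel (\<lambda>v. v powr (- p) * indicator {1..} v :: real)"
proof (rule integrableI_nonneg)
  have "(\<integral>\<^sup>+v. ennreal (v powr (- p)) * indicator {1..} v \<partial>lborel) = ennreal (0 - (- (1 powr (1 - p)) / (p - 1)))"
  proof (rule nn_integral_FTC_atLeast[where F = "\<lambda>v. - (v powr (1 - p)) / (p - 1)"])
    fix v :: real assume "1 \<le> v"
    then have "((\<lambda>v. - (v powr (1 - p)) / (p - 1)) has_real_derivative - ((1 - p) * v powr (1 - p - 1)) / (p - 1)) (at v)"
      using assms by (intro derivative_eq_intros refl) auto
    also have "- ((1 - p) * v powr (1 - p - 1)) / (p - 1) = v powr (- p)"
      using assms by (simp add: field_simps)
    finally show "((\<lambda>v. - (v powr (1 - p)) / (p - 1)) has_real_derivative v powr (- p)) (at v)" .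
  next
    have "((\<lambda>v. v powr (1 - p)) \<longlongrightarrow> 0) at_top"
      using assms by (intro tendsto_neg_powr filterlim_ident) auto
    then have "((\<lambda>v. - (v powr (1 - p)) / (p - 1)) \<longlongrightarrow> - 0 / (p - 1)) at_top"
      using assms by (intro tendsto_intros) auto
    then show "((\<lambda>v. - (v powr (1 - p)) / (p - 1)) \<longlongrightarrow> 0) at_top" by simp
  qed auto
  then show "(\<integral>\<^sup>+v. ennreal (v powr (- p) * indicator {1..} v) \<partial>lborel) < \<infinity>"
    by (simp add: ennreal_mult' ennreal_indicator)
qed auto

text \<open>The kernel is at most 1 near the origin, and at most \<mu> v^(-1/\<beta>) for large v
  because 1 - exp (-z) \<le> z; the latter tail is integrable since 1/\<beta> > 1.\<close>

lemma pareto_kernel_integrable: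
  assumes \<beta>: "0 < \<beta>" "\<beta> < 1" and \<mu>: "0 \<le> \<mu>"
  shows "integrable lborel (pareto_kernel \<beta> \<mu>)"
proof (rule Bochner_Integration.integrable_bound)
  show "integrable lborel (\<lambda>v. indicator {0..1} v + \<mu> * (v powr (- (1 / \<beta>)) * indicator {1..} v) :: real)"
    using \<beta> by (intro Bochner_Integration.integrable_add integrable_mult_right integrable_powr_tail) auto
  have "norm (pareto_kernel \<beta> \<mu> v)
      \<le> norm (indicator {0..1} v + \<mu> * (v powr (- (1 / \<beta>)) * indicator {1..} v) :: real)" for v
  proof (cases "v \<le> 1")
    case True
    then show ?thesis
      using pareto_kernel_bounds[OF \<mu>, of \<beta> v] \<mu>
      by (cases "0 < v"; cases "v = 1") (auto simp: pareto_kernel_def[of _ _ v] indicator_def add_nonneg_nonneg)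
  next
    case False
    then have "pareto_kernel \<beta> \<mu> v \<le> \<mu> * v powr (- (1 / \<beta>))"
      using exp_ge_add_one_self[of "- (\<mu> * v powr (- 1 / \<beta>))"] by (simp add: pareto_kernel_def)
    then show ?thesis
      using False pareto_kernel_bounds[OF \<mu>, of \<beta> v] \<mu> by simp
  qed
  then show "AE v in lborel. norm (pareto_kernel \<beta> \<mu> v)
      \<le> norm (indicator {0..1} v + \<mu> * (v powr (- (1 / \<beta>)) * indicator {1..} v) :: real)"
    by simp
qed auto

text \<open>Replacing v by \<mu>^\<beta> v turns \<mu> v^(-1/\<beta>) into v^(-1/\<beta>). This
  scaling is where the exponent \<beta> of the stable law arises.\<close>

lemma pareto_kernel_integral_scale:
  assumes \<beta>: "0 < \<beta>" "\<beta> < 1" and \<mu>: "0 \<le> \<mu>"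
  shows "(\<integral>v. pareto_kernel \<beta> \<mu> v \<partial>lborel) = \<mu> powr \<beta> * (\<integral>v. pareto_kernel \<beta> 1 v \<partial>lborel)"
proof (cases "\<mu> = 0")
  case False
  with \<mu> have m: "0 < \<mu>" by simp
  have "pareto_kernel \<beta> \<mu> (0 + \<mu> powr \<beta> * v) = pareto_kernel \<beta> 1 v" for v
  proof (cases "0 < v")
    case True
    have "(\<mu> powr \<beta> * v) powr (- 1 / \<beta>) = \<mu> powr (- 1) * v powr (- 1 / \<beta>)"
      using True m \<beta> by (simp add: powr_mult powr_powr)
    then show ?thesis
      using True m by (simp add: pareto_kernel_def powr_minus_divide indicator_def zero_less_mult_iff)
  qed (use m in \<open>auto simp: pareto_kernel_def indicator_def zero_less_mult_iff\<close>)
  then show ?thesis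
    using m lborel_integral_real_affine[of "\<mu> powr \<beta>" "pareto_kernel \<beta> \<mu>" 0] by simp
qed (simp add: pareto_kernel_def)

text \<open>On (0, 1] the kernel is at least 1 - 1/e. Positivity allows the limit law to be
  normalised by this integral.\<close>

lemma pareto_kernel_integral_pos:
  assumes \<beta>: "0 < \<beta>" "\<beta> < 1"
  shows "0 < (\<integral>v. pareto_kernel \<beta> 1 v \<partial>lborel)"
proof -
  have "(\<integral>v. (1 - exp (- 1)) * indicator {0<..1::real} v \<partial>lborel) \<le> (\<integral>v. pareto_kernel \<beta> 1 v \<partial>lborel)"
  proof (rule Bochner_Integration.integral_mono)
    show "integrable lborel (pareto_kernel \<beta> 1)" using \<beta> by (intro pareto_kernel_integrable) auto
    show "(1 - exp (- 1)) * indicator {0<..1} v \<le> pareto_kernel \<beta> 1 v" for v :: real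
    proof (cases "v \<in> {0<..1}")
      case True
      then have "1 powr (- 1 / \<beta>) \<le> v powr (- 1 / \<beta>)"
        using \<beta> by (intro powr_mono2') auto
      then show ?thesis using True by (simp add: pareto_kernel_def)
    qed (use pareto_kernel_bounds[of 1 \<beta> v] in auto)
  qed auto
  moreover have "(\<integral>v. (1 - exp (- 1)) * indicator {0<..1::real} v \<partial>lborel) = 1 - exp (- 1 :: real)"
    by simp
  moreover have "0 < 1 - exp (- 1 :: real)" by simp
  ultimately show ?thesis by linarith
qed

section \<open>Laplace transforms of rescaled Pareto sums\<close>

definition unit_uniform :: "real measure" where
  "unit_uniform = density lborel (\<lambda>u. ennreal (indicator {0<..1} u))"

lemma sets_unit_uniform [measurable_cong, simp]: "sets unit_uniform = sets borel"
  by (simp add: unit_uniform_def)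

lemma prob_space_unit_uniform: "prob_space unit_uniform"
  by (rule prob_spaceI) (simp add: unit_uniform_def emeasure_density ennreal_indicator)

text \<open>On (0, 1] the exponential is one minus the kernel at v = n u, and the change of
  variables contributes the factor 1/n.\<close>

lemma unit_uniform_laplace:
  assumes \<beta>: "0 < \<beta>" "\<beta> < 1" and \<mu>: "0 \<le> \<mu>" and n: "0 < n"
  shows "(\<integral>u. exp (- (\<mu> * (real n * u) powr (- 1 / \<beta>))) \<partial>unit_uniform)
    = 1 - (\<integral>v. pareto_kernel \<beta> \<mu> v * indicator {..real n} v \<partial>lborel) / real n"
proof -
  let ?f = "\<lambda>v. pareto_kernel \<beta> \<mu> v * indicator {..real n} v"
  have int: "integrable lborel ?f"
    using integrable_mult_indicator[of "{..real n}", OF _ pareto_kernel_integrable[OF \<beta> \<mu>]]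
    by (simp add: mult.commute)
  have "(\<integral>u. exp (- (\<mu> * (real n * u) powr (- 1 / \<beta>))) \<partial>unit_uniform)
      = (\<integral>u. indicator {0<..1} u *\<^sub>R exp (- (\<mu> * (real n * u) powr (- 1 / \<beta>))) \<partial>lborel)"
    unfolding unit_uniform_def by (rule integral_density) auto
  also have "\<dots> = (\<integral>u. indicator {0<..1} u - ?f (0 + real n * u) \<partial>lborel)"
    using n by (intro Bochner_Integration.integral_cong)
      (auto simp: pareto_kernel_def indicator_def zero_less_mult_iff)
  also have "\<dots> = (\<integral>u. indicator {0<..1::real} u \<partial>lborel) - (\<integral>u. ?f (0 + real n * u) \<partial>lborel)"
  proof (rule Bochner_Integration.integral_diff)
    show "integrable lborel (\<lambda>u. ?f (0 + real n * u))"
      using n by (intro lborel_integrable_real_affine[OF int]) simp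
  qed simp
  also have "(\<integral>u. ?f (0 + real n * u) \<partial>lborel) = (\<integral>v. ?f v \<partial>lborel) / real n"
    using n lborel_integral_real_affine[of "real n" ?f 0] by simp
  finally show ?thesis by simp
qed

text \<open>For uniform U, the variable U^(-1/\<beta>) is Pareto with tail v^(-\<beta>). The sum is
  thus \<kappa> n^(-1/\<beta>) times a sum of n i.i.d. Pareto variables, the normalisation of the
  stable limit theorem.\<close>

definition pareto_sum :: "real \<Rightarrow> real \<Rightarrow> nat \<Rightarrow> (nat \<Rightarrow> real) \<Rightarrow> real" where
  "pareto_sum \<beta> \<kappa> n \<omega> = (\<Sum>i<n. \<kappa> * (real n * \<omega> i) powr (- 1 / \<beta>))"

lemma pareto_sum_measurable [measurable]:
  "pareto_sum \<beta> \<kappa> n \<in> borel_measurable (PiM {..<n} (\<lambda>_. unit_uniform))"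
  unfolding pareto_sum_def by measurable

lemma pareto_sum_laplace:
  assumes \<beta>: "0 < \<beta>" "\<beta> < 1" and "0 \<le> \<kappa>" "0 \<le> l" "0 < n"
  shows "(\<integral>\<omega>. exp (- (l * pareto_sum \<beta> \<kappa> n \<omega>)) \<partial>PiM {..<n} (\<lambda>_. unit_uniform))
    = (1 - (\<integral>v. pareto_kernel \<beta> (l * \<kappa>) v * indicator {..real n} v \<partial>lborel) / real n) ^ n"
proof -
  interpret U: prob_space unit_uniform by (rule prob_space_unit_uniform)
  interpret P: product_sigma_finite "\<lambda>_::nat. unit_uniform"
    by unfold_locales
  let ?f = "\<lambda>u. exp (- (l * \<kappa> * (real n * u) powr (- 1 / \<beta>)))"
  have "exp (- (l * pareto_sum \<beta> \<kappa> n \<omega>)) = (\<Prod>i<n. ?f (\<omega> i))" for \<omega>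
    by (simp add: pareto_sum_def sum_distrib_left exp_sum mult.assoc flip: sum_negf)
  then have "(\<integral>\<omega>. exp (- (l * pareto_sum \<beta> \<kappa> n \<omega>)) \<partial>PiM {..<n} (\<lambda>_. unit_uniform))
      = (\<integral>\<omega>. (\<Prod>i<n. ?f (\<omega> i)) \<partial>PiM {..<n} (\<lambda>_. unit_uniform))"
    by simp
  also have "\<dots> = (\<Prod>i<n. \<integral>u. ?f u \<partial>unit_uniform)"
  proof (rule P.product_integral_prod)
    show "integrable unit_uniform ?f"
      using assms by (intro U.integrable_const_bound[where B = 1]) auto
  qed simp
  also have "\<dots> = (1 - (\<integral>v. pareto_kernel \<beta> (l * \<kappa>) v * indicator {..real n} v \<partial>lborel) / real n) ^ n"
    using unit_uniform_laplace[OF \<beta>, of "l * \<kappa>" n] assms by simp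
  finally show ?thesis .
qed

text \<open>Squeezed between the same power with A in place of \<open>a n\<close>, which tends to
  exp (-A), and exp (- \<open>a n\<close>), by 1 - z \<le> exp (-z). The bound of \<open>a n\<close>
  by \<open>Suc n\<close> keeps the base nonnegative, as monotonicity of powers requires.\<close>

lemma one_minus_over_n_power_tendsto:
  assumes "a \<longlonglongrightarrow> (A::real)" "\<And>n. a n \<le> A" "\<And>n. a n \<le> real (Suc n)"
  shows "(\<lambda>n. (1 - a n / real (Suc n)) ^ Suc n) \<longlonglongrightarrow> exp (- A)"
proof (rule tendsto_sandwich)
  show "(\<lambda>n. (1 - A / real (Suc n)) ^ Suc n) \<longlonglongrightarrow> exp (- A)"
    using LIMSEQ_Suc[OF tendsto_exp_limit_sequentially[of "- A"]] by simp
  show "(\<lambda>n. exp (- a n)) \<longlonglongrightarrow> exp (- A)"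
    by (intro tendsto_intros assms)
  show "eventually (\<lambda>n. (1 - A / real (Suc n)) ^ Suc n \<le> (1 - a n / real (Suc n)) ^ Suc n) sequentially"
  proof (rule eventually_sequentiallyI[of "nat \<lceil>A\<rceil>"])
    fix n assume "nat \<lceil>A\<rceil> \<le> n"
    then have "A \<le> real (Suc n)" by linarith
    then show "(1 - A / real (Suc n)) ^ Suc n \<le> (1 - a n / real (Suc n)) ^ Suc n"
      using assms(2)[of n] by (intro power_mono diff_left_mono divide_right_mono) (auto simp: field_simps)
  qed
  show "eventually (\<lambda>n. (1 - a n / real (Suc n)) ^ Suc n \<le> exp (- a n)) sequentially"
  proof (intro always_eventually allI)
    fix n
    have "(1 - a n / real (Suc n)) ^ Suc n \<le> exp (- (a n / real (Suc n))) ^ Suc n"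
      using exp_ge_add_one_self[of "- (a n / real (Suc n))"] assms(3)[of n]
      by (intro power_mono) (auto simp: field_simps)
    also have "\<dots> = exp (- a n)"
      unfolding exp_of_nat_mult[symmetric] by (simp del: of_nat_Suc)
    finally show "(1 - a n / real (Suc n)) ^ Suc n \<le> exp (- a n)" .
  qed
qed

text \<open>The laws of the Pareto sums are tight, so a subsequence converges weakly. Their Laplace
  transforms converge to exp (-l^\<beta>), and so does the transform of the limit. The absolute
  value in the exponent makes the integrand bounded and continuous on the whole line, as weak
  convergence demands; nonnegativity of the limit is shown separately.\<close>

lemma positive_stable_exists:
  assumes \<beta>: "0 < \<beta>" "\<beta> < 1"
  obtains \<nu> where "real_distribution \<nu>" "AE x in \<nu>. 0 \<le> x"
    "\<And>l. 0 \<le> l \<Longrightarrow> (\<integral>x. exp (- (l * \<bar>x\<bar>)) \<partial>\<nu>) = exp (- (l powr \<beta>))"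
proof -
  define c0 where "c0 = (\<integral>v. pareto_kernel \<beta> 1 v \<partial>lborel)"
  \<comment> \<open>Chosen so that \<kappa>^\<beta> \<open>c0\<close> = 1; the kernel integral at l
    \<kappa> is then exactly l^\<beta>.\<close>
  define \<kappa> where "\<kappa> = (1 / c0) powr (1 / \<beta>)"
  have c0: "0 < c0" unfolding c0_def by (rule pareto_kernel_integral_pos[OF \<beta>])
  then have \<kappa>: "0 < \<kappa>" "\<kappa> powr \<beta> * c0 = 1"
    using \<beta> by (auto simp: \<kappa>_def powr_powr)
  have full: "(\<integral>v. pareto_kernel \<beta> (l * \<kappa>) v \<partial>lborel) = l powr \<beta>" if "0 \<le> l" for l
    using pareto_kernel_integral_scale[OF \<beta>, of "l * \<kappa>"] that \<kappa>
    by (simp add: powr_mult mult.assoc flip: c0_def)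
  define a where "a l n = (\<integral>v. pareto_kernel \<beta> (l * \<kappa>) v * indicator {..real (Suc n)} v \<partial>lborel)" for l n
  have a_le: "a l n \<le> l powr \<beta>" if "0 \<le> l" for l n
    unfolding full[OF that, symmetric] a_def
  proof (rule integral_mono')
    show "integrable lborel (pareto_kernel \<beta> (l * \<kappa>))"
      using that \<kappa> by (intro pareto_kernel_integrable[OF \<beta>]) auto
  qed (use that \<kappa> pareto_kernel_bounds[of "l * \<kappa>" \<beta>] in \<open>auto simp: indicator_def\<close>)
  have a_lim: "a l \<longlonglongrightarrow> l powr \<beta>" if "0 \<le> l" for l
    unfolding full[OF that, symmetric] a_def
  proof (rule integral_dominated_convergence[where w = "pareto_kernel \<beta> (l * \<kappa>)"])
    show "integrable lborel (pareto_kernel \<beta> (l * \<kappa>))"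
      using that \<kappa> by (intro pareto_kernel_integrable[OF \<beta>]) auto
    have "(\<lambda>n. pareto_kernel \<beta> (l * \<kappa>) v * indicator {..real (Suc n)} v) \<longlonglongrightarrow> pareto_kernel \<beta> (l * \<kappa>) v" for v
    proof (rule tendsto_eventually, rule eventually_sequentiallyI[of "nat \<lceil>v\<rceil>"])
      fix n assume "nat \<lceil>v\<rceil> \<le> n"
      then have "v \<le> real (Suc n)" by linarith
      then show "pareto_kernel \<beta> (l * \<kappa>) v * indicator {..real (Suc n)} v = pareto_kernel \<beta> (l * \<kappa>) v"
        by simp
    qed
    then show "AE v in lborel. (\<lambda>n. pareto_kernel \<beta> (l * \<kappa>) v * indicator {..real (Suc n)} v) \<longlonglongrightarrow> pareto_kernel \<beta> (l * \<kappa>) v"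
      by simp
    show "AE v in lborel. norm (pareto_kernel \<beta> (l * \<kappa>) v * indicator {..real (Suc n)} v) \<le> pareto_kernel \<beta> (l * \<kappa>) v" for n
      using that \<kappa> pareto_kernel_bounds[of "l * \<kappa>" \<beta>] by (auto simp: indicator_def)
  qed auto
  let ?P = "\<lambda>n. PiM {..<Suc n} (\<lambda>_. unit_uniform)"
  let ?X = "\<lambda>n. pareto_sum \<beta> \<kappa> (Suc n)"
  define \<mu> where "\<mu> n = distr (?P n) borel (?X n)" for n
  have prob_P: "prob_space (?P n)" for n
    by (intro prob_space_PiM prob_space_unit_uniform)
  have X_nonneg: "0 \<le> ?X n \<omega>" for n \<omega>
    unfolding pareto_sum_def using \<kappa> by (intro sum_nonneg) auto
  have dist: "real_distribution (\<mu> n)" for n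
    unfolding \<mu>_def using prob_space.real_distribution_distr[OF prob_P] by simp
  have laplace: "(\<integral>x. exp (- (l * \<bar>x\<bar>)) \<partial>\<mu> n) = (1 - a l n / real (Suc n)) ^ Suc n" if "0 \<le> l" for l n
  proof -
    have "(\<integral>x. exp (- (l * \<bar>x\<bar>)) \<partial>\<mu> n) = (\<integral>\<omega>. exp (- (l * ?X n \<omega>)) \<partial>?P n)"
      unfolding \<mu>_def using X_nonneg by (subst integral_distr) auto
    also have "\<dots> = (1 - a l n / real (Suc n)) ^ Suc n"
      unfolding a_def using \<kappa> that by (intro pareto_sum_laplace[OF \<beta>]) auto
    finally show ?thesis .
  qed
  have a_le_n: "a l n \<le> real (Suc n)" if "0 \<le> l" for l n
  proof -
    have "0 \<le> (\<integral>u. exp (- (l * \<kappa> * (real (Suc n) * u) powr (- 1 / \<beta>))) \<partial>unit_uniform)"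
      by simp
    also have "\<dots> = 1 - a l n / real (Suc n)"
      unfolding a_def using that \<kappa> by (intro unit_uniform_laplace[OF \<beta>]) auto
    finally show ?thesis by (simp add: field_simps)
  qed
  \<comment> \<open>A Markov-type bound from the Laplace transform at 1/b: beyond b, 1 - exp (-x/b)
    is at least 1 - 1/e, and Bernoulli's inequality bounds its mean by \<open>a (1 / b) n\<close>,
    uniformly in n.\<close>
  have tail: "(1 - exp (- 1)) * measure (\<mu> n) {b<..} \<le> b powr (- \<beta>)" if "0 < b" for b n
  proof -
    interpret real_distribution "\<mu> n" by (rule dist)
    have int: "integrable (\<mu> n) (\<lambda>x. exp (- (1 / b * \<bar>x\<bar>)))"
      using that by (intro integrable_const_bound[where B = 1]) auto
    have "(1 - exp (- 1)) * measure (\<mu> n) {b<..} = (\<integral>x. (1 - exp (- 1)) * indicator {b<..} x \<partial>\<mu> n)"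
      by simp
    also have "\<dots> \<le> (\<integral>x. 1 - exp (- (1 / b * \<bar>x\<bar>)) \<partial>\<mu> n)"
    proof (rule integral_mono')
      show "integrable (\<mu> n) (\<lambda>x. 1 - exp (- (1 / b * \<bar>x\<bar>)))"
        using int by simp
      show "(1 - exp (- 1)) * indicator {b<..} x \<le> 1 - exp (- (1 / b * \<bar>x\<bar>))" for x
        using that by (cases "b < x") (auto simp: field_simps)
      show "0 \<le> 1 - exp (- (1 / b * \<bar>x\<bar>))" for x
        using that by simp
    qed
    also have "\<dots> = 1 - (1 - a (1 / b) n / real (Suc n)) ^ Suc n"
      using int laplace[of "1 / b" n] that prob_space by simp
    also have "\<dots> \<le> a (1 / b) n"
    proof -
      have "1 + real (Suc n) * (- (a (1 / b) n / real (Suc n))) \<le> (1 + - (a (1 / b) n / real (Suc n))) ^ Suc n"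
        using a_le_n[of "1 / b" n] that by (intro Bernoulli_inequality) (auto simp: field_simps)
      then show ?thesis by simp
    qed
    also have "\<dots> \<le> (1 / b) powr \<beta>"
      using that by (intro a_le) auto
    also have "\<dots> = b powr (- \<beta>)"
      using that by (simp add: powr_divide powr_minus_divide)
    finally show ?thesis .
  qed
  have "tight \<mu>"
    unfolding tight_def
  proof (intro conjI allI impI dist)
    fix e :: real assume e: "0 < e"
    define d where "d = 1 - exp (- 1 :: real)"
    have d: "0 < d" by (simp add: d_def)
    \<comment> \<open>With this b the tail bound gives mass at most e/2 beyond b. On the left any
      negative endpoint works, since the sums are nonnegative.\<close>
    define b where "b = (e * d / 2) powr (- 1 / \<beta>)"
    have b: "0 < b" "b powr (- \<beta>) = e * d / 2"
      using e d \<beta> by (auto simp: b_def powr_powr)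
    have "1 - e < measure (\<mu> n) {-1<..b}" for n
    proof -
      interpret real_distribution "\<mu> n" by (rule dist)
      have "d * measure (\<mu> n) {b<..} \<le> d * (e / 2)"
        using tail[OF b(1), of n] b by (simp add: d_def)
      then have small: "measure (\<mu> n) {b<..} \<le> e / 2"
        using d by simp
      have "1 = measure (\<mu> n) {-1<..}"
      proof -
        have "measure (\<mu> n) {-1<..} = measure (?P n) (?X n -` {-1<..} \<inter> space (?P n))"
          unfolding \<mu>_def by (intro measure_distr) auto
        also have "?X n -` {-1<..} \<inter> space (?P n) = space (?P n)"
          by (auto intro!: less_le_trans[OF _ X_nonneg])
        finally show ?thesis using prob_space.prob_space[OF prob_P] by simp
      qed
      also have "{-1<..} = {-1<..b} \<union> {b<..}" using b by auto
      also have "measure (\<mu> n) ({-1<..b} \<union> {b<..}) \<le> measure (\<mu> n) {-1<..b} + measure (\<mu> n) {b<..}"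
        by (intro measure_Un_le) auto
      finally show ?thesis using small e by linarith
    qed
    then show "\<exists>a b. a < b \<and> (\<forall>n. 1 - e < measure (\<mu> n) {a<..b})"
      using b by (intro exI[of _ "-1"] exI[of _ b]) auto
  qed
  from tight_imp_convergent_subsubsequence[OF this strict_mono_id] obtain r \<nu>
    where r: "strict_mono r" and \<nu>: "real_distribution \<nu>" and conv: "weak_conv_m (\<mu> \<circ> id \<circ> r) \<nu>"
    by blast
  have conv: "weak_conv_m (\<lambda>n. \<mu> (r n)) \<nu>"
    using conv by (simp add: comp_def)
  interpret \<nu>: real_distribution \<nu> by (rule \<nu>)
  note lim = weak_conv_imp_integral_bdd_continuous_conv[OF dist \<nu> conv]
  show thesis
  proof
    show "real_distribution \<nu>" by (rule \<nu>)
    show "(\<integral>x. exp (- (l * \<bar>x\<bar>)) \<partial>\<nu>) = exp (- (l powr \<beta>))" if l: "0 \<le> l" for l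
    proof (rule LIMSEQ_unique)
      show "(\<lambda>n. \<integral>x. exp (- (l * \<bar>x\<bar>)) \<partial>\<mu> (r n)) \<longlonglongrightarrow> (\<integral>x. exp (- (l * \<bar>x\<bar>)) \<partial>\<nu>)"
        by (rule lim[where B = 1]) (use l in auto)
      have "(\<lambda>n. (1 - a l n / real (Suc n)) ^ Suc n) \<longlonglongrightarrow> exp (- (l powr \<beta>))"
        by (intro one_minus_over_n_power_tendsto a_lim a_le a_le_n l)
      from LIMSEQ_subseq_LIMSEQ[OF this r]
      show "(\<lambda>n. \<integral>x. exp (- (l * \<bar>x\<bar>)) \<partial>\<mu> (r n)) \<longlonglongrightarrow> exp (- (l powr \<beta>))"
        unfolding laplace[OF l] comp_def .
    qed
    \<comment> \<open>A bounded continuous test function that is positive exactly on the negative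
      axis. It integrates to 0 under every approximating law, hence under the limit.\<close>
    let ?g = "\<lambda>x::real. min 1 (max 0 (- x))"
    have "(\<lambda>n. \<integral>x. ?g x \<partial>\<mu> (r n)) \<longlonglongrightarrow> (\<integral>x. ?g x \<partial>\<nu>)"
      by (rule lim[where B = 1]) (auto intro!: continuous_intros)
    moreover have "(\<integral>x. ?g x \<partial>\<mu> (r n)) = 0" for n
    proof -
      have "(\<integral>x. ?g x \<partial>\<mu> (r n)) = (\<integral>\<omega>. ?g (?X (r n) \<omega>) \<partial>?P (r n))"
        unfolding \<mu>_def by (subst integral_distr) auto
      also have "\<dots> = (\<integral>\<omega>. 0 \<partial>?P (r n))"
      proof (intro Bochner_Integration.integral_cong refl)
        show "?g (?X (r n) \<omega>) = 0" for \<omega>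
          using X_nonneg[of "r n" \<omega>] by (simp add: max_absorb1)
      qed
      finally show ?thesis by simp
    qed
    ultimately have "(\<integral>x. ?g x \<partial>\<nu>) = 0"
      by (simp add: LIMSEQ_const_iff)
    moreover have "integrable \<nu> ?g"
      by (intro \<nu>.integrable_const_bound[where B = 1]) auto
    ultimately have "AE x in \<nu>. ?g x = 0"
      by (subst (asm) integral_nonneg_eq_0_iff_AE) auto
    then show "AE x in \<nu>. 0 \<le> x"
      by eventually_elim (auto simp: min_def max_def split: if_splits)
  qed
qed

subsection \<open>The ratio of two positive stable variables\<close>

text \<open>Minus the derivative of the Laplace transform at u. For l > u/2 the differentiated
  integrand is bounded by 2/u, since z exp (-z) \<le> 1, so differentiation under the integral sign
  applies.\<close>

lemma (in real_distribution) stable_moment_transform: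
  assumes \<beta>: "0 < \<beta>"
    and laplace: "\<And>l. 0 \<le> l \<Longrightarrow> (\<integral>x. exp (- (l * \<bar>x\<bar>)) \<partial>M) = exp (- (l powr \<beta>))"
    and u: "0 < u"
  shows "integrable M (\<lambda>x. \<bar>x\<bar> * exp (- (u * \<bar>x\<bar>)))"
    and "(\<integral>x. \<bar>x\<bar> * exp (- (u * \<bar>x\<bar>)) \<partial>M) = \<beta> * u powr (\<beta> - 1) * exp (- (u powr \<beta>))"
proof -
  have bound: "\<bar>x\<bar> * exp (- (l * \<bar>x\<bar>)) \<le> 2 / u" if "u / 2 < l" for l x :: real
  proof -
    have "l * \<bar>x\<bar> * exp (- (l * \<bar>x\<bar>)) \<le> exp (l * \<bar>x\<bar>) * exp (- (l * \<bar>x\<bar>))"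
    proof (rule mult_right_mono)
      show "l * \<bar>x\<bar> \<le> exp (l * \<bar>x\<bar>)"
        using exp_ge_add_one_self[of "l * \<bar>x\<bar>"] by linarith
    qed simp
    also have "\<dots> = 1" by (simp flip: exp_add)
    finally have *: "l * (\<bar>x\<bar> * exp (- (l * \<bar>x\<bar>))) \<le> 1" by (simp add: mult.assoc)
    have "(u / 2) * (\<bar>x\<bar> * exp (- (l * \<bar>x\<bar>))) \<le> l * (\<bar>x\<bar> * exp (- (l * \<bar>x\<bar>)))"
      using that by (intro mult_right_mono) auto
    with * have "(u / 2) * (\<bar>x\<bar> * exp (- (l * \<bar>x\<bar>))) \<le> 1" by linarith
    then show ?thesis using u by (simp add: field_simps)
  qed
  have "integrable M (\<lambda>x. \<bar>x\<bar> * exp (- (u * \<bar>x\<bar>)))"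
    using bound[of u] u by (intro integrable_const_bound[where B = "2 / u"]) auto
  then show "integrable M (\<lambda>x. \<bar>x\<bar> * exp (- (u * \<bar>x\<bar>)))" .
  have "((\<lambda>l. \<integral>x. exp (- (l * \<bar>x\<bar>)) \<partial>M) has_field_derivative (\<integral>x. - \<bar>x\<bar> * exp (- (u * \<bar>x\<bar>)) \<partial>M)) (at u)"
  proof (rule has_field_derivative_integral[where S = "{u / 2<..}" and K = "2 / u"])
    show "integrable M (\<lambda>x. exp (- (w * \<bar>x\<bar>)))" if "w \<in> {u / 2<..}" for w
      using u that by (intro integrable_const_bound[where B = 1]) auto
    show "((\<lambda>w. exp (- (w * \<bar>x\<bar>))) has_real_derivative - \<bar>x\<bar> * exp (- (w * \<bar>x\<bar>))) (at w)" for w x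
      by (auto intro!: derivative_eq_intros)
  qed (use u bound in \<open>auto simp: norm_mult\<close>)
  moreover have "((\<lambda>l. \<integral>x. exp (- (l * \<bar>x\<bar>)) \<partial>M) has_field_derivative
      - (\<beta> * u powr (\<beta> - 1)) * exp (- (u powr \<beta>))) (at u)"
  proof (rule has_field_derivative_transform_within_open[where S = "{0<..}"])
    show "((\<lambda>l. exp (- (l powr \<beta>))) has_real_derivative
      - (\<beta> * u powr (\<beta> - 1)) * exp (- (u powr \<beta>))) (at u)"
      using u by (auto intro!: derivative_eq_intros)
  qed (use u laplace in auto)
  ultimately have "(\<integral>x. - \<bar>x\<bar> * exp (- (u * \<bar>x\<bar>)) \<partial>M) = - (\<beta> * u powr (\<beta> - 1)) * exp (- (u powr \<beta>))"
    by (rule DERIV_unique)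
  then show "(\<integral>x. \<bar>x\<bar> * exp (- (u * \<bar>x\<bar>)) \<partial>M) = \<beta> * u powr (\<beta> - 1) * exp (- (u powr \<beta>))"
    by simp
qed

text \<open>The antiderivative - exp (-c u^\<beta>) / c rises from -1/c at 0 to 0 at infinity. For
  \<beta> < 1 the integrand is unbounded at 0, so the fundamental theorem is used on the open
  half-line.\<close>

lemma nn_integral_weibull:
  fixes \<beta> c :: real
  assumes \<beta>: "0 < \<beta>" and c: "0 < c"
  shows "(\<integral>\<^sup>+u. ennreal (\<beta> * u powr (\<beta> - 1) * exp (- (c * u powr \<beta>))) * indicator {0<..} u \<partial>lborel) = ennreal (1 / c)"
proof -
  let ?f = "\<lambda>u::real. \<beta> * u powr (\<beta> - 1) * exp (- (c * u powr \<beta>))"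
  let ?F = "\<lambda>u::real. - (exp (- (c * u powr \<beta>)) / c)"
  have ein: "einterval (ereal 0) \<infinity> = {0<..}"
    by (auto simp: einterval_def)
  have F: "(?F has_real_derivative ?f u) (at u)" if "ereal 0 < ereal u" for u
    using that c by (auto intro!: derivative_eq_intros)
  have cont: "isCont ?f u" if "ereal 0 < ereal u" for u
    using that by (auto intro!: continuous_intros)
  have A: "((?F \<circ> real_of_ereal) \<longlongrightarrow> - (1 / c)) (at_right (ereal 0))"
  proof -
    have "((\<lambda>u. u powr \<beta>) \<longlongrightarrow> 0 powr \<beta>) (at_right (0::real))"
      using \<beta> by (intro tendsto_powr2 tendsto_intros) (auto simp: eventually_at_filter)
    then have "((\<lambda>u. - (exp (- (c * u powr \<beta>)) / c)) \<longlongrightarrow> - (exp (- (c * 0)) / c)) (at_right (0::real))"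
      using c by (intro tendsto_intros) auto
    then show ?thesis by (simp add: ereal_tendsto_simps)
  qed
  have B: "((?F \<circ> real_of_ereal) \<longlongrightarrow> 0) (at_left \<infinity>)"
  proof -
    have "((\<lambda>u::real. exp (- (c * u powr \<beta>))) \<longlongrightarrow> 0) at_top"
      using \<beta> c by real_asymp
    then have "(?F \<longlongrightarrow> - (0 / c)) at_top"
      using c by (intro tendsto_intros) auto
    then show ?thesis by (simp add: ereal_tendsto_simps)
  qed
  have nonneg: "AE u in lborel. ereal 0 < ereal u \<longrightarrow> ereal u < \<infinity> \<longrightarrow> 0 \<le> ?f u"
    using \<beta> by simp
  have "set_integrable lborel {0<..} ?f" "(LBINT u=ereal 0..\<infinity>. ?f u) = 0 - - (1 / c)"
    using interval_integral_FTC_nonneg[OF _ F cont nonneg A B] by (auto simp: ein)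
  moreover have "(LBINT u=ereal 0..\<infinity>. ?f u) = (LBINT u:{0<..}. ?f u)"
    by (simp add: interval_lebesgue_integral_def ein)
  ultimately have *: "integrable lborel (\<lambda>u. indicator {0<..} u * ?f u)"
      "(\<integral>u. indicator {0<..} u * ?f u \<partial>lborel) = 1 / c"
    by (auto simp: set_integrable_def set_lebesgue_integral_def)
  have "(\<integral>\<^sup>+u. ennreal (?f u) * indicator {0<..} u \<partial>lborel) = (\<integral>\<^sup>+u. ennreal (indicator {0<..} u * ?f u) \<partial>lborel)"
    by (intro nn_integral_cong) (auto simp: indicator_def)
  also have "\<dots> = ennreal (1 / c)"
    using * \<beta> by (subst nn_integral_eq_integral) auto
  finally show ?thesis .
qed

lemma nn_integral_exp_scaled:
  fixes c d :: real
  assumes "0 < c" "0 \<le> d"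
  shows "(\<integral>\<^sup>+u. ennreal (d * exp (- (u * c))) * indicator {0<..} u \<partial>lborel) = ennreal (d / c)"
proof -
  have "(\<integral>\<^sup>+u. ennreal (d * exp (- (u * c))) * indicator {0<..} u \<partial>lborel)
      = (\<integral>\<^sup>+u. ennreal d * (ennreal (exp (- (c * u powr 1))) * indicator {0<..} u) \<partial>lborel)"
    using assms by (intro nn_integral_cong) (auto simp: indicator_def ennreal_mult' mult.commute)
  also have "\<dots> = ennreal d * (\<integral>\<^sup>+u. ennreal (exp (- (c * u powr 1))) * indicator {0<..} u \<partial>lborel)"
    by (intro nn_integral_cmult) auto
  also have "(\<integral>\<^sup>+u. ennreal (exp (- (c * u powr 1))) * indicator {0<..} u \<partial>lborel)
      = (\<integral>\<^sup>+u. ennreal (1 * u powr (1 - 1) * exp (- (c * u powr 1))) * indicator {0<..} u \<partial>lborel)"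
    by (intro nn_integral_cong) (auto simp: indicator_def)
  also have "\<dots> = ennreal (1 / c)"
    using assms by (intro nn_integral_weibull) auto
  finally show ?thesis
    using assms by (simp flip: ennreal_mult')
qed

text \<open>For positive A and B, y / (A/B + y) = y B / (A + y B), which is the integral of y B exp
  (-u (A + y B)) over u > 0. After Fubini, independence splits the expectation into the Laplace
  transform of A at u and the moment transform of B at u y. Their product is y^\<beta> times a
  Weibull integrand with c = 1 + y^\<beta>.\<close>

lemma (in real_distribution) stable_ratio_stieltjes:
  assumes \<beta>: "0 < \<beta>"
    and pos: "AE x in M. 0 < x"
    and laplace: "\<And>l. 0 \<le> l \<Longrightarrow> (\<integral>x. exp (- (l * \<bar>x\<bar>)) \<partial>M) = exp (- (l powr \<beta>))"
    and y: "0 < y"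
  shows "(\<integral>p. y / (\<bar>fst p / snd p\<bar> + y) \<partial>(M \<Otimes>\<^sub>M M)) = y powr \<beta> / (1 + y powr \<beta>)"
proof -
  interpret P: pair_prob_space M M ..
  interpret PL: pair_sigma_finite "M \<Otimes>\<^sub>M M" lborel ..
  have posP: "AE p in M \<Otimes>\<^sub>M M. 0 < fst p \<and> 0 < snd p"
  proof (rule P.AE_pair_measure)
    show "AE x in M. AE z in M. 0 < fst (x, z) \<and> 0 < snd (x, z)"
      using pos by eventually_elim (use pos in \<open>auto elim: eventually_mono\<close>)
    show "{p \<in> space (M \<Otimes>\<^sub>M M). 0 < fst p \<and> 0 < snd p} \<in> sets (M \<Otimes>\<^sub>M M)"
      by measurable
  qed
  let ?k = "\<lambda>p u. ennreal (y * \<bar>snd p\<bar> * exp (- (u * (\<bar>fst p\<bar> + y * \<bar>snd p\<bar>)))) * indicator {0<..} u"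
  have "(\<integral>\<^sup>+p. ennreal (y / (\<bar>fst p / snd p\<bar> + y)) \<partial>(M \<Otimes>\<^sub>M M))
      = (\<integral>\<^sup>+p. (\<integral>\<^sup>+u. ?k p u \<partial>lborel) \<partial>(M \<Otimes>\<^sub>M M))"
  proof (rule nn_integral_cong_AE)
    show "AE p in M \<Otimes>\<^sub>M M. ennreal (y / (\<bar>fst p / snd p\<bar> + y)) = (\<integral>\<^sup>+u. ?k p u \<partial>lborel)"
      using posP
    proof eventually_elim
      fix p :: "real \<times> real" assume p: "0 < fst p \<and> 0 < snd p"
      have "(\<integral>\<^sup>+u. ?k p u \<partial>lborel) = ennreal (y * \<bar>snd p\<bar> / (\<bar>fst p\<bar> + y * \<bar>snd p\<bar>))"
        using p y by (intro nn_integral_exp_scaled) (auto intro: add_pos_pos)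
      also have "y * \<bar>snd p\<bar> / (\<bar>fst p\<bar> + y * \<bar>snd p\<bar>) = y / (\<bar>fst p / snd p\<bar> + y)"
        using p y by (simp add: field_simps)
      finally show "ennreal (y / (\<bar>fst p / snd p\<bar> + y)) = (\<integral>\<^sup>+u. ?k p u \<partial>lborel)" by simp
    qed
  qed
  also have "\<dots> = (\<integral>\<^sup>+u. (\<integral>\<^sup>+p. ?k p u \<partial>(M \<Otimes>\<^sub>M M)) \<partial>lborel)"
    by (rule PL.Fubini'[symmetric]) measurable
  also have "\<dots> = (\<integral>\<^sup>+u. ennreal (y powr \<beta>) * (ennreal (\<beta> * u powr (\<beta> - 1) * exp (- ((1 + y powr \<beta>) * u powr \<beta>))) * indicator {0<..} u) \<partial>lborel)"
  proof (rule nn_integral_cong)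
    fix u :: real
    show "(\<integral>\<^sup>+p. ?k p u \<partial>(M \<Otimes>\<^sub>M M))
      = ennreal (y powr \<beta>) * (ennreal (\<beta> * u powr (\<beta> - 1) * exp (- ((1 + y powr \<beta>) * u powr \<beta>))) * indicator {0<..} u)"
    proof (cases "0 < u")
      case True
      have uy: "0 < u * y" using True y by simp
      have mom: "integrable M (\<lambda>x. \<bar>x\<bar> * exp (- (u * y * \<bar>x\<bar>)))"
        "(\<integral>x. \<bar>x\<bar> * exp (- (u * y * \<bar>x\<bar>)) \<partial>M) = \<beta> * (u * y) powr (\<beta> - 1) * exp (- ((u * y) powr \<beta>))"
        using laplace by (intro stable_moment_transform[OF \<beta> _ uy]; simp)+
      have int: "integrable M (\<lambda>x. exp (- (u * \<bar>x\<bar>)))"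
        using True by (intro integrable_const_bound[where B = 1]) auto
      have "(\<integral>\<^sup>+p. ?k p u \<partial>(M \<Otimes>\<^sub>M M)) = (\<integral>\<^sup>+a. (\<integral>\<^sup>+b. ?k (a, b) u \<partial>M) \<partial>M)"
        by (rule nn_integral_fst[symmetric]) measurable
      also have "\<dots> = (\<integral>\<^sup>+a. ennreal (exp (- (u * \<bar>a\<bar>))) * (\<integral>\<^sup>+b. ennreal (y * (\<bar>b\<bar> * exp (- (u * y * \<bar>b\<bar>)))) \<partial>M) \<partial>M)"
      proof (intro nn_integral_cong)
        fix a
        have "(\<integral>\<^sup>+b. ?k (a, b) u \<partial>M) = (\<integral>\<^sup>+b. ennreal (exp (- (u * \<bar>a\<bar>))) * ennreal (y * (\<bar>b\<bar> * exp (- (u * y * \<bar>b\<bar>)))) \<partial>M)"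
          using True y by (intro nn_integral_cong)
            (simp add: ennreal_mult'[symmetric] exp_add[symmetric] algebra_simps exp_diff exp_minus divide_inverse)
        also have "\<dots> = ennreal (exp (- (u * \<bar>a\<bar>))) * (\<integral>\<^sup>+b. ennreal (y * (\<bar>b\<bar> * exp (- (u * y * \<bar>b\<bar>)))) \<partial>M)"
          by (rule nn_integral_cmult) measurable
        finally show "(\<integral>\<^sup>+b. ?k (a, b) u \<partial>M) = ennreal (exp (- (u * \<bar>a\<bar>))) * (\<integral>\<^sup>+b. ennreal (y * (\<bar>b\<bar> * exp (- (u * y * \<bar>b\<bar>)))) \<partial>M)" .
      qed
      also have "(\<integral>\<^sup>+b. ennreal (y * (\<bar>b\<bar> * exp (- (u * y * \<bar>b\<bar>)))) \<partial>M)
          = ennreal (y * (\<beta> * (u * y) powr (\<beta> - 1) * exp (- ((u * y) powr \<beta>))))"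
        using mom y by (subst nn_integral_eq_integral) auto
      also have "(\<integral>\<^sup>+a. ennreal (exp (- (u * \<bar>a\<bar>))) * ennreal (y * (\<beta> * (u * y) powr (\<beta> - 1) * exp (- ((u * y) powr \<beta>)))) \<partial>M)
          = (\<integral>\<^sup>+a. ennreal (exp (- (u * \<bar>a\<bar>))) \<partial>M) * ennreal (y * (\<beta> * (u * y) powr (\<beta> - 1) * exp (- ((u * y) powr \<beta>))))"
        by (rule nn_integral_multc) measurable
      also have "(\<integral>\<^sup>+a. ennreal (exp (- (u * \<bar>a\<bar>))) \<partial>M) = ennreal (exp (- (u powr \<beta>)))"
        using int laplace[of u] True by (subst nn_integral_eq_integral) auto
      also have "ennreal (exp (- (u powr \<beta>))) * ennreal (y * (\<beta> * (u * y) powr (\<beta> - 1) * exp (- ((u * y) powr \<beta>))))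
          = ennreal (y powr \<beta> * (\<beta> * u powr (\<beta> - 1) * exp (- ((1 + y powr \<beta>) * u powr \<beta>))))"
      proof -
        have p1: "y * y powr (\<beta> - 1) = y powr \<beta>"
          using y by (simp add: powr_diff)
        have p2: "exp (- (u powr \<beta>)) * exp (- ((u * y) powr \<beta>)) = exp (- ((1 + y powr \<beta>) * u powr \<beta>))"
          using True y by (simp add: powr_mult algebra_simps flip: exp_add)
        have p3: "(u * y) powr (\<beta> - 1) = u powr (\<beta> - 1) * y powr (\<beta> - 1)"
          using True y by (simp add: powr_mult)
        have p4: "exp (- (u powr \<beta>)) * (y * (\<beta> * (u * y) powr (\<beta> - 1) * exp (- ((u * y) powr \<beta>))))
            = y powr \<beta> * (\<beta> * u powr (\<beta> - 1) * exp (- ((1 + y powr \<beta>) * u powr \<beta>)))"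
          unfolding p2[symmetric] unfolding p1[symmetric] p3 by (simp only: mult_ac)
        show ?thesis
          unfolding p4[symmetric] by (rule ennreal_mult'[symmetric]) simp
      qed
      finally show ?thesis
        using True \<beta> by (simp add: ennreal_mult')
    qed simp
  qed
  also have "\<dots> = ennreal (y powr \<beta>) * (\<integral>\<^sup>+u. ennreal (\<beta> * u powr (\<beta> - 1) * exp (- ((1 + y powr \<beta>) * u powr \<beta>))) * indicator {0<..} u \<partial>lborel)"
    by (rule nn_integral_cmult) measurable
  also have "\<dots> = ennreal (y powr \<beta>) * ennreal (1 / (1 + y powr \<beta>))"
    using \<beta> by (subst nn_integral_weibull) (auto intro: add_pos_nonneg)
  also have "\<dots> = ennreal (y powr \<beta> / (1 + y powr \<beta>))"
    by (simp flip: ennreal_mult')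
  finally have *: "(\<integral>\<^sup>+p. ennreal (y / (\<bar>fst p / snd p\<bar> + y)) \<partial>(M \<Otimes>\<^sub>M M)) = ennreal (y powr \<beta> / (1 + y powr \<beta>))" .
  show ?thesis
    by (rule integral_eq_nn_integral[THEN trans])
       (use * y in \<open>auto simp: enn2real_ennreal add_nonneg_nonneg\<close>)
qed

text \<open>Stieltjes inversion for the ratio of two independent copies. As \<beta> < 1/2, the angle
  \<beta>\<pi> is below \<pi>/2, so 1 + y^\<beta> e^(i\<pi>\<beta>) has positive real part and its
  argument is the arctangent in \<open>sector_angle\<close>.\<close>

lemma (in real_distribution) stable_ratio_cdf_ge:
  assumes \<beta>: "0 < \<beta>" "\<beta> < 1 / 2"
    and pos: "AE x in M. 0 < x"
    and laplace: "\<And>l. 0 \<le> l \<Longrightarrow> (\<integral>x. exp (- (l * \<bar>x\<bar>)) \<partial>M) = exp (- (l powr \<beta>))"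
    and y: "0 < y"
  shows "sector_angle (\<beta> * pi) (y powr \<beta>) \<le> \<beta> * pi * measure (M \<Otimes>\<^sub>M M) {p \<in> space (M \<Otimes>\<^sub>M M). \<bar>fst p / snd p\<bar> \<le> y}"
proof -
  interpret P: pair_prob_space M M ..
  have "Im (Ln (1 + of_real (y powr \<beta>) * cis (\<beta> * pi)))
      \<le> \<beta> * pi * measure (M \<Otimes>\<^sub>M M) {p \<in> space (M \<Otimes>\<^sub>M M). \<bar>fst p / snd p\<bar> \<le> y}"
    by (rule P.stieltjes_cdf_ge)
       (use \<beta> y stable_ratio_stieltjes[OF _ pos laplace] in auto)
  moreover have "0 < 1 + y powr \<beta> * cos (\<beta> * pi)"
  proof -
    have "0 < cos (\<beta> * pi)" using \<beta> by (intro cos_gt_zero_pi) (auto simp: field_simps intro: less_trans[of _ 0])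
    then show ?thesis by (intro add_pos_nonneg) auto
  qed
  then have "Im (Ln (1 + of_real (y powr \<beta>) * cis (\<beta> * pi))) = sector_angle (\<beta> * pi) (y powr \<beta>)"
    by (subst Im_Ln_eq) (auto simp: sector_angle_def complex_eq_iff)
  ultimately show ?thesis by simp
qed

subsection \<open>The ratio of two symmetric stable variables\<close>

text \<open>The mass at 0 is at most the Laplace transform exp (-l^\<beta>) for every l \<ge> 0, and
  this tends to 0 as l grows.\<close>

lemma (in real_distribution) stable_pos:
  assumes "AE x in M. 0 \<le> x" and "0 < \<beta>"
    and laplace: "\<And>l. 0 \<le> l \<Longrightarrow> (\<integral>x. exp (- (l * \<bar>x\<bar>)) \<partial>M) = exp (- (l powr \<beta>))"
  shows "AE x in M. 0 < x"
proof -
  have le: "prob {0} \<le> exp (- (l powr \<beta>))" if "0 \<le> l" for l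
  proof -
    have "prob {0} = (\<integral>x. indicator {0} x \<partial>M)" by simp
    also have "\<dots> \<le> (\<integral>x. exp (- (l * \<bar>x\<bar>)) \<partial>M)"
    proof (rule integral_mono')
      show "integrable M (\<lambda>x. exp (- (l * \<bar>x\<bar>)))"
        using that by (intro integrable_const_bound[where B = 1]) auto
    qed (auto simp: indicator_def)
    finally show ?thesis using laplace[OF that] by simp
  qed
  have "((\<lambda>l. exp (- (l powr \<beta>))) \<longlongrightarrow> 0) at_top"
    using \<open>0 < \<beta>\<close> by real_asymp
  then have "prob {0} \<le> 0"
    by (rule tendsto_lowerbound) (use le in \<open>auto simp: eventually_at_top_linorder intro!: exI[of _ 0]\<close>)
  then have "emeasure M {0} = 0"
    by (simp add: emeasure_eq_measure measure_le_0_iff)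
  then have "AE x in M. x \<noteq> 0"
    by (intro AE_I[of _ _ "{0}"]) auto
  with assms(1) show ?thesis
    by eventually_elim auto
qed

text \<open>Given the first coordinate a, the characteristic function of sqrt (2 |a|) G at t is exp
  (-t^2 |a|). Averaging over a gives the Laplace transform at t^2, that is exp (-|t|^\<alpha>), and
  characteristic functions determine laws.\<close>

lemma sym_stable_normal_mixture:
  assumes \<alpha>: "0 < \<alpha>" and \<mu>: "real_distribution \<mu>" "sym_stable \<alpha> \<mu>" and \<nu>: "real_distribution \<nu>"
    and laplace: "\<And>l. 0 \<le> l \<Longrightarrow> (\<integral>x. exp (- (l * \<bar>x\<bar>)) \<partial>\<nu>) = exp (- (l powr (\<alpha> / 2)))"
  shows "\<mu> = distr (\<nu> \<Otimes>\<^sub>M std_normal_distribution) borel (\<lambda>p. sqrt (2 * \<bar>fst p\<bar>) * snd p)"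
proof (rule Levy_uniqueness[OF \<mu>(1)])
  interpret \<nu>: real_distribution \<nu> by (rule \<nu>)
  interpret \<gamma>: real_distribution std_normal_distribution by (rule real_dist_normal_dist)
  interpret P: pair_prob_space \<nu> std_normal_distribution ..
  let ?D = "distr (\<nu> \<Otimes>\<^sub>M std_normal_distribution) borel (\<lambda>p. sqrt (2 * \<bar>fst p\<bar>) * snd p)"
  show "real_distribution ?D"
    by (intro P.real_distribution_distr) measurable
  show "char \<mu> = char ?D"
  proof
    fix t
    have "char ?D t = (\<integral>p. iexp (t * (sqrt (2 * \<bar>fst p\<bar>) * snd p)) \<partial>(\<nu> \<Otimes>\<^sub>M std_normal_distribution))"
      unfolding char_def by (intro integral_distr) measurable
    also have "\<dots> = (\<integral>a. (\<integral>g. iexp (t * (sqrt (2 * \<bar>a\<bar>) * g)) \<partial>std_normal_distribution) \<partial>\<nu>)"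
      by (subst P.integral_fst'[symmetric]) (auto intro!: P.integrable_const_bound[where B = 1])
    also have "\<dots> = (\<integral>a. char std_normal_distribution (t * sqrt (2 * \<bar>a\<bar>)) \<partial>\<nu>)"
      unfolding char_def by (simp add: mult.assoc)
    also have "\<dots> = (\<integral>a. complex_of_real (exp (- (t\<^sup>2 * \<bar>a\<bar>))) \<partial>\<nu>)"
      unfolding char_std_normal_distribution by (simp add: power_mult_distrib)
    also have "\<dots> = complex_of_real (exp (- ((t\<^sup>2) powr (\<alpha> / 2))))"
      by (subst integral_complex_of_real) (simp add: laplace)
    also have "(t\<^sup>2) powr (\<alpha> / 2) = \<bar>t\<bar> powr \<alpha>"
    proof (cases "t = 0")
      case False
      then have "t\<^sup>2 = \<bar>t\<bar> powr 2" by simp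
      then show ?thesis by (simp only: powr_powr) simp
    qed (use \<alpha> in simp)
    finally show "char \<mu> t = char ?D t"
      using \<mu>(2) by (simp add: sym_stable_def)
  qed
qed

lemma AE_std_normal_nonzero: "AE x in std_normal_distribution. x \<noteq> 0"
  by (subst AE_density) (use AE_lborel_singleton[of 0] in \<open>auto elim: eventually_mono\<close>)

text \<open>Both angle inequalities at c = \<pi>\<alpha>/2 and X = \<delta>^\<alpha> = t^(1 -
  \<alpha>). The thresholds \<delta>^2 k and \<delta>^2 / k, raised to the power \<alpha>/2, become
  X k^(\<alpha>/2) and X / k^(\<alpha>/2).\<close>

lemma (in real_distribution) stable_ratio_cdf_sym_ge:
  assumes \<alpha>: "0 < \<alpha>" "\<alpha> < 1"
    and pos: "AE x in M. 0 < x"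
    and laplace: "\<And>l. 0 \<le> l \<Longrightarrow> (\<integral>x. exp (- (l * \<bar>x\<bar>)) \<partial>M) = exp (- (l powr (\<alpha> / 2)))"
    and \<delta>: "0 < \<delta>" "\<delta> \<le> 1" and k: "0 < k"
  defines "H y \<equiv> measure (M \<Otimes>\<^sub>M M) {p \<in> space (M \<Otimes>\<^sub>M M). \<bar>fst p / snd p\<bar> \<le> y}"
    and "t \<equiv> \<delta> powr (\<alpha> / (1 - \<alpha>))"
  shows "2 * (t / (1 + t)) \<le> H (\<delta>\<^sup>2 * k) + H (\<delta>\<^sup>2 / k)"
proof -
  define c where "c = \<alpha> / 2 * pi"
  define X where "X = \<delta> powr \<alpha>"
  have c: "0 < c" "c < pi / 2" and c1: "1 - 2 * c / pi = 1 - \<alpha>"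
    using \<alpha> by (auto simp: c_def field_simps)
  have t: "0 < t" "t \<le> 1" using \<delta> \<alpha> by (auto simp: t_def powr_le1)
  have X: "0 < X" "X \<le> 1" "t powr (1 - \<alpha>) = X"
    using \<delta> \<alpha> by (auto simp: X_def t_def powr_le1 powr_powr)
  have \<delta>2: "(\<delta>\<^sup>2) powr (\<alpha> / 2) = X"
  proof -
    have "\<delta>\<^sup>2 = \<delta> powr 2" using \<delta> by simp
    then show ?thesis by (simp only: X_def powr_powr) simp
  qed
  have H: "sector_angle c (y powr (\<alpha> / 2)) \<le> c * H y" if "0 < y" for y
    unfolding H_def c_def using \<alpha> that by (intro stable_ratio_cdf_ge[OF _ _ pos laplace]) auto
  have "c * (t / (1 + t)) \<le> sector_angle c X"
    using sector_angle_ge[OF c t] by (simp only: c1 X(3))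
  then have "c * (2 * (t / (1 + t))) \<le> 2 * sector_angle c X"
    by (subst mult.left_commute) linarith
  also have "\<dots> \<le> sector_angle c (X * k powr (\<alpha> / 2)) + sector_angle c (X / k powr (\<alpha> / 2))"
    using k by (intro sector_angle_scale_ge c X) auto
  also have "\<dots> \<le> c * H (\<delta>\<^sup>2 * k) + c * H (\<delta>\<^sup>2 / k)"
    using H[of "\<delta>\<^sup>2 * k"] H[of "\<delta>\<^sup>2 / k"] \<delta> k by (simp add: powr_mult powr_divide \<delta>2)
  also have "\<dots> = c * (H (\<delta>\<^sup>2 * k) + H (\<delta>\<^sup>2 / k))"
    by (simp add: algebra_simps)
  finally show ?thesis
    using c(1) by (simp only: mult_le_cancel_left_pos)
qed

text \<open>Both variables are written as normal mixtures. The normal factors g and h have the same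
  law, so twice the probability is the mean of \<open>q g h + q h g\<close>. This sum is bounded
  below for nonzero g and h, which is almost everywhere, though a single summand need not
  be.\<close>

lemma sym_stable_ratio_prob_ge:
  assumes \<alpha>: "0 < \<alpha>" "\<alpha> < 1" and \<mu>: "real_distribution \<mu>" "sym_stable \<alpha> \<mu>"
    and \<delta>: "0 < \<delta>" "\<delta> \<le> 1"
  defines "t \<equiv> \<delta> powr (\<alpha> / (1 - \<alpha>))"
  shows "ennreal (t / (1 + t)) \<le> emeasure (\<mu> \<Otimes>\<^sub>M \<mu>) {p. \<bar>fst p\<bar> \<le> \<delta> * \<bar>snd p\<bar>}"
proof -
  have half: "0 < \<alpha> / 2" "\<alpha> / 2 < 1" using \<alpha> by auto
  obtain \<nu> where \<nu>: "real_distribution \<nu>" "AE x in \<nu>. 0 \<le> x"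
    and laplace: "\<And>l. 0 \<le> l \<Longrightarrow> (\<integral>x. exp (- (l * \<bar>x\<bar>)) \<partial>\<nu>) = exp (- (l powr (\<alpha> / 2)))"
    using positive_stable_exists[OF half] by blast
  define \<gamma> where "\<gamma> = std_normal_distribution"
  interpret \<nu>: real_distribution \<nu> by (rule \<nu>)
  interpret \<gamma>: real_distribution \<gamma> unfolding \<gamma>_def by (rule real_dist_normal_dist)
  interpret \<mu>: real_distribution \<mu> by (rule \<mu>)
  interpret \<nu>\<gamma>: pair_prob_space \<nu> \<gamma> ..
  interpret \<gamma>\<nu>: pair_prob_space \<gamma> \<nu> ..
  interpret \<nu>\<nu>: pair_prob_space \<nu> \<nu> ..
  interpret \<gamma>\<gamma>: pair_prob_space \<gamma> \<gamma> ..
  interpret \<mu>\<mu>: pair_prob_space \<mu> \<mu> ..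
  have pos: "AE x in \<nu>. 0 < x"
    using \<nu>.stable_pos[OF \<nu>(2) _ laplace] \<alpha> by simp
  have law: "\<mu> = distr (\<nu> \<Otimes>\<^sub>M \<gamma>) borel (\<lambda>p. sqrt (2 * \<bar>fst p\<bar>) * snd p)"
    unfolding \<gamma>_def by (rule sym_stable_normal_mixture[OF \<alpha>(1) \<mu> \<nu>(1) laplace])
  have mix: "(\<integral>\<^sup>+x. f x \<partial>\<mu>) = (\<integral>\<^sup>+a. \<integral>\<^sup>+g. f (sqrt (2 * \<bar>a\<bar>) * g) \<partial>\<gamma> \<partial>\<nu>)"
    if [measurable]: "f \<in> borel_measurable borel" for f
  proof -
    have "(\<integral>\<^sup>+x. f x \<partial>\<mu>) = (\<integral>\<^sup>+p. f (sqrt (2 * \<bar>fst p\<bar>) * snd p) \<partial>(\<nu> \<Otimes>\<^sub>M \<gamma>))"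
      by (subst law, subst nn_integral_distr) measurable
    also have "\<dots> = (\<integral>\<^sup>+a. \<integral>\<^sup>+g. f (sqrt (2 * \<bar>a\<bar>) * g) \<partial>\<gamma> \<partial>\<nu>)"
      by (subst \<gamma>.nn_integral_fst[symmetric]) simp_all
    finally show ?thesis .
  qed
  define G :: "real \<Rightarrow> real \<Rightarrow> ennreal" where "G u v = indicator {p. \<bar>fst p\<bar> \<le> \<delta> * \<bar>snd p\<bar>} (u, v)" for u v
  have [measurable]: "(\<lambda>p. G (f p) (g p)) \<in> borel_measurable N"
    if [measurable]: "f \<in> borel_measurable N" "g \<in> borel_measurable N" for f g and N :: "'n measure"
    unfolding G_def by measurable
  \<comment> \<open>The conditional probability of the event given the normal factors g and h. The
    exchanges of integrals below move both integrations over \<open>\<nu>\<close> inside to reach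
    it.\<close>
  define q where "q g h = (\<integral>\<^sup>+a. \<integral>\<^sup>+b. G (sqrt (2 * \<bar>a\<bar>) * g) (sqrt (2 * \<bar>b\<bar>) * h) \<partial>\<nu> \<partial>\<nu>)" for g h
  have [measurable]: "(\<lambda>p. q (f p) (g p)) \<in> borel_measurable N"
    if [measurable]: "f \<in> borel_measurable N" "g \<in> borel_measurable N" for f g and N :: "'n measure"
    unfolding q_def by measurable
  define H where "H y = measure (\<nu> \<Otimes>\<^sub>M \<nu>) {p \<in> space (\<nu> \<Otimes>\<^sub>M \<nu>). \<bar>fst p / snd p\<bar> \<le> y}" for y
  have "emeasure (\<mu> \<Otimes>\<^sub>M \<mu>) {p. \<bar>fst p\<bar> \<le> \<delta> * \<bar>snd p\<bar>} = (\<integral>\<^sup>+p. G (fst p) (snd p) \<partial>(\<mu> \<Otimes>\<^sub>M \<mu>))"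
  proof -
    have "{p \<in> space (\<mu> \<Otimes>\<^sub>M \<mu>). \<bar>fst p\<bar> \<le> \<delta> * \<bar>snd p\<bar>} \<in> sets (\<mu> \<Otimes>\<^sub>M \<mu>)"
      by measurable
    then have "{p. \<bar>fst p\<bar> \<le> \<delta> * \<bar>snd p\<bar>} \<in> sets (\<mu> \<Otimes>\<^sub>M \<mu>)"
      by (simp add: space_pair_measure)
    from nn_integral_indicator[OF this] show ?thesis
      by (simp add: G_def)
  qed
  also have "\<dots> = (\<integral>\<^sup>+u. \<integral>\<^sup>+v. G u v \<partial>\<mu> \<partial>\<mu>)"
    by (subst \<mu>.nn_integral_fst[symmetric]) simp_all
  also have "\<dots> = (\<integral>\<^sup>+a. \<integral>\<^sup>+g. \<integral>\<^sup>+b. \<integral>\<^sup>+h. G (sqrt (2 * \<bar>a\<bar>) * g) (sqrt (2 * \<bar>b\<bar>) * h) \<partial>\<gamma> \<partial>\<nu> \<partial>\<gamma> \<partial>\<nu>)"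
    by (simp add: mix)
  also have "\<dots> = (\<integral>\<^sup>+a. \<integral>\<^sup>+g. \<integral>\<^sup>+h. \<integral>\<^sup>+b. G (sqrt (2 * \<bar>a\<bar>) * g) (sqrt (2 * \<bar>b\<bar>) * h) \<partial>\<nu> \<partial>\<gamma> \<partial>\<gamma> \<partial>\<nu>)"
    by (subst \<nu>\<gamma>.Fubini') simp_all
  also have "\<dots> = (\<integral>\<^sup>+g. \<integral>\<^sup>+a. \<integral>\<^sup>+h. \<integral>\<^sup>+b. G (sqrt (2 * \<bar>a\<bar>) * g) (sqrt (2 * \<bar>b\<bar>) * h) \<partial>\<nu> \<partial>\<gamma> \<partial>\<nu> \<partial>\<gamma>)"
    by (rule \<gamma>\<nu>.Fubini') measurable
  also have "\<dots> = (\<integral>\<^sup>+g. \<integral>\<^sup>+h. q g h \<partial>\<gamma> \<partial>\<gamma>)"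
    unfolding q_def by (intro nn_integral_cong \<gamma>\<nu>.Fubini') measurable
  finally have E1: "emeasure (\<mu> \<Otimes>\<^sub>M \<mu>) {p. \<bar>fst p\<bar> \<le> \<delta> * \<bar>snd p\<bar>} = (\<integral>\<^sup>+g. \<integral>\<^sup>+h. q g h \<partial>\<gamma> \<partial>\<gamma>)" .
  have E2: "(\<integral>\<^sup>+g. \<integral>\<^sup>+h. q g h \<partial>\<gamma> \<partial>\<gamma>) = (\<integral>\<^sup>+g. \<integral>\<^sup>+h. q h g \<partial>\<gamma> \<partial>\<gamma>)"
    by (rule \<gamma>\<gamma>.Fubini') measurable
  \<comment> \<open>Squaring the inequality of the event shows that, given g and h, it is a bound on
    the ratio of the mixing variables by \<delta>^2 k with k = h^2 / g^2. Exchanging g and h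
    replaces k by 1/k.\<close>
  have q_ge: "ennreal (H (\<delta>\<^sup>2 * (h\<^sup>2 / g\<^sup>2))) \<le> q g h" if "g \<noteq> 0" for g h
  proof -
    let ?A = "{p \<in> space (\<nu> \<Otimes>\<^sub>M \<nu>). \<bar>fst p / snd p\<bar> \<le> \<delta>\<^sup>2 * (h\<^sup>2 / g\<^sup>2)}"
    have "ennreal (H (\<delta>\<^sup>2 * (h\<^sup>2 / g\<^sup>2))) = emeasure (\<nu> \<Otimes>\<^sub>M \<nu>) ?A"
      by (simp add: H_def \<nu>\<nu>.emeasure_eq_measure)
    also have "\<dots> = (\<integral>\<^sup>+p. indicator ?A p \<partial>(\<nu> \<Otimes>\<^sub>M \<nu>))"
      by (rule nn_integral_indicator[symmetric]) measurable
    also have "\<dots> = (\<integral>\<^sup>+a. \<integral>\<^sup>+b. indicator ?A (a, b) \<partial>\<nu> \<partial>\<nu>)"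
      by (rule \<nu>.nn_integral_fst[symmetric]) measurable
    also have "\<dots> \<le> q g h"
      unfolding q_def
    proof (rule nn_integral_mono, rule nn_integral_mono_AE)
      fix a
      show "AE b in \<nu>. indicator ?A (a, b) \<le> G (sqrt (2 * \<bar>a\<bar>) * g) (sqrt (2 * \<bar>b\<bar>) * h)"
        using pos
      proof eventually_elim
        fix b :: real assume b: "0 < b"
        have "\<bar>sqrt (2 * \<bar>a\<bar>) * g\<bar> \<le> \<delta> * \<bar>sqrt (2 * \<bar>b\<bar>) * h\<bar>" if "\<bar>a / b\<bar> \<le> \<delta>\<^sup>2 * (h\<^sup>2 / g\<^sup>2)"
        proof -
          have "\<bar>a\<bar> * g\<^sup>2 \<le> \<delta>\<^sup>2 * h\<^sup>2 * b"
            using that b \<open>g \<noteq> 0\<close> by (simp add: field_simps)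
          then have "(2 * \<bar>a\<bar>) * g\<^sup>2 \<le> \<delta>\<^sup>2 * ((2 * \<bar>b\<bar>) * h\<^sup>2)"
            using b by (simp add: algebra_simps)
          then have "sqrt ((2 * \<bar>a\<bar>) * g\<^sup>2) \<le> sqrt (\<delta>\<^sup>2 * ((2 * \<bar>b\<bar>) * h\<^sup>2))"
            by (rule real_sqrt_le_mono)
          then show ?thesis
            using \<delta> by (simp add: real_sqrt_mult abs_mult)
        qed
        then show "indicator ?A (a, b) \<le> G (sqrt (2 * \<bar>a\<bar>) * g) (sqrt (2 * \<bar>b\<bar>) * h)"
          by (auto simp: G_def indicator_def)
      qed
    qed
    finally show ?thesis .
  qed
  have sum_ge: "ennreal (2 * (t / (1 + t))) \<le> q g h + q h g" if "g \<noteq> 0" "h \<noteq> 0" for g h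
  proof -
    have "2 * (t / (1 + t)) \<le> H (\<delta>\<^sup>2 * (h\<^sup>2 / g\<^sup>2)) + H (\<delta>\<^sup>2 / (h\<^sup>2 / g\<^sup>2))"
      unfolding H_def t_def using that
      by (intro \<nu>.stable_ratio_cdf_sym_ge[OF \<alpha> pos laplace \<delta>]) auto
    also have "\<delta>\<^sup>2 / (h\<^sup>2 / g\<^sup>2) = \<delta>\<^sup>2 * (g\<^sup>2 / h\<^sup>2)" by simp
    finally have "ennreal (2 * (t / (1 + t))) \<le> ennreal (H (\<delta>\<^sup>2 * (h\<^sup>2 / g\<^sup>2)) + H (\<delta>\<^sup>2 * (g\<^sup>2 / h\<^sup>2)))"
      by (rule ennreal_leI)
    also have "\<dots> = ennreal (H (\<delta>\<^sup>2 * (h\<^sup>2 / g\<^sup>2))) + ennreal (H (\<delta>\<^sup>2 * (g\<^sup>2 / h\<^sup>2)))"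
      by (rule ennreal_plus) (simp_all add: H_def)
    also have "\<dots> \<le> q g h + q h g"
      by (intro add_mono q_ge that)
    finally show ?thesis .
  qed
  note nz = AE_std_normal_nonzero[folded \<gamma>_def]
  have "ennreal (2 * (t / (1 + t))) = (\<integral>\<^sup>+g. \<integral>\<^sup>+h. ennreal (2 * (t / (1 + t))) \<partial>\<gamma> \<partial>\<gamma>)"
    using \<gamma>.emeasure_space_1 by simp
  also have "\<dots> \<le> (\<integral>\<^sup>+g. \<integral>\<^sup>+h. q g h + q h g \<partial>\<gamma> \<partial>\<gamma>)"
  proof (rule nn_integral_mono_AE)
    show "AE g in \<gamma>. (\<integral>\<^sup>+h. ennreal (2 * (t / (1 + t))) \<partial>\<gamma>) \<le> (\<integral>\<^sup>+h. q g h + q h g \<partial>\<gamma>)"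
      using nz
    proof eventually_elim
      fix g :: real assume g: "g \<noteq> 0"
      show "(\<integral>\<^sup>+h. ennreal (2 * (t / (1 + t))) \<partial>\<gamma>) \<le> (\<integral>\<^sup>+h. q g h + q h g \<partial>\<gamma>)"
      proof (rule nn_integral_mono_AE)
        show "AE h in \<gamma>. ennreal (2 * (t / (1 + t))) \<le> q g h + q h g"
          using nz by eventually_elim (rule sum_ge[OF g])
      qed
    qed
  qed
  also have "\<dots> = (\<integral>\<^sup>+g. \<integral>\<^sup>+h. q g h \<partial>\<gamma> \<partial>\<gamma>) + (\<integral>\<^sup>+g. \<integral>\<^sup>+h. q h g \<partial>\<gamma> \<partial>\<gamma>)"
    by (subst nn_integral_add[symmetric]) (auto intro!: nn_integral_cong nn_integral_add)
  also have "\<dots> = 2 * emeasure (\<mu> \<Otimes>\<^sub>M \<mu>) {p. \<bar>fst p\<bar> \<le> \<delta> * \<bar>snd p\<bar>}"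
    by (simp add: E1 E2[symmetric] mult_2)
  finally show ?thesis
    unfolding \<mu>\<mu>.emeasure_eq_measure
    by (simp add: ennreal_mult''[symmetric] flip: ennreal_numeral)
qed

subsection \<open>The absolute minimum estimator\<close>

lemma (in prob_space) char_distr_cmult:
  assumes [measurable]: "random_variable borel X"
  shows "char (distr M borel (\<lambda>\<omega>. a * X \<omega>)) t = char (distr M borel X) (t * a)"
  unfolding char_def by (simp add: integral_distr mult_ac)

lemma sym_stable_unique:
  assumes "real_distribution \<mu>" "real_distribution \<mu>'" "sym_stable \<alpha> \<mu>" "sym_stable \<alpha> \<mu>'"
  shows "\<mu> = \<mu>'"
  using assms by (intro Levy_uniqueness) (auto simp: sym_stable_def)

text \<open>By independence the characteristic functions multiply; the exponents
  |\<open>a p\<close>|^\<alpha> |t|^\<alpha> add up to |t|^\<alpha> under the normalisation.\<close>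

lemma (in prob_space) sym_stable_linear_combination:
  assumes \<alpha>: "0 < \<alpha>" and "finite I"
    and ind: "indep_vars (\<lambda>_. borel) X I"
    and st: "\<And>p. p \<in> I \<Longrightarrow> sym_stable \<alpha> (distr M borel (X p))"
    and norm: "(\<Sum>p\<in>I. \<bar>a p\<bar> powr \<alpha>) = 1"
  shows "sym_stable \<alpha> (distr M borel (\<lambda>\<omega>. \<Sum>p\<in>I. a p * X p \<omega>))"
  unfolding sym_stable_def
proof
  fix t
  have rv: "random_variable borel (X p)" if "p \<in> I" for p
    using ind that by (auto simp: indep_vars_def)
  have "char (distr M borel (\<lambda>\<omega>. \<Sum>p\<in>I. a p * X p \<omega>)) t = (\<Prod>p\<in>I. char (distr M borel (\<lambda>\<omega>. a p * X p \<omega>)) t)"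
    by (intro char_distr_sum indep_vars_compose2[OF ind]) auto
  also have "\<dots> = (\<Prod>p\<in>I. complex_of_real (exp (- (\<bar>a p\<bar> powr \<alpha> * \<bar>t\<bar> powr \<alpha>))))"
  proof (intro prod.cong refl)
    fix p assume p: "p \<in> I"
    show "char (distr M borel (\<lambda>\<omega>. a p * X p \<omega>)) t = complex_of_real (exp (- (\<bar>a p\<bar> powr \<alpha> * \<bar>t\<bar> powr \<alpha>)))"
      using st[OF p] by (simp add: char_distr_cmult[OF rv[OF p]] sym_stable_def abs_mult powr_mult mult.commute)
  qed
  also have "\<dots> = complex_of_real (exp (\<Sum>p\<in>I. - (\<bar>a p\<bar> powr \<alpha> * \<bar>t\<bar> powr \<alpha>)))"
    using \<open>finite I\<close> by (simp add: exp_sum)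
  also have "(\<Sum>p\<in>I. - (\<bar>a p\<bar> powr \<alpha> * \<bar>t\<bar> powr \<alpha>)) = - (\<bar>t\<bar> powr \<alpha>)"
    using norm by (simp add: sum_negf flip: sum_distrib_right)
  finally show "char (distr M borel (\<lambda>\<omega>. \<Sum>p\<in>I. a p * X p \<omega>)) t = complex_of_real (exp (- (\<bar>t\<bar> powr \<alpha>)))" .
qed

text \<open>The existence of some k < M makes the index set nonempty, so a minimiser exists and the
  \<open>LEAST\<close> in \<open>argmin_idx\<close> really selects one.\<close>

lemma abs_xhat_min_le:
  assumes "k < M"
  shows "\<bar>xhat_min x s N M i \<omega>\<bar> \<le> \<bar>meas x s N k \<omega> / s i k \<omega>\<bar>"
proof -
  let ?f = "\<lambda>j. \<bar>meas x s N j \<omega> / s i j \<omega>\<bar>"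
  obtain j where "j \<in> {..<M}" "\<And>k. k \<in> {..<M} \<Longrightarrow> ?f j \<le> ?f k"
    using ex_is_arg_min_if_finite[of "{..<M}" ?f] assms
    by (auto simp: is_arg_min_linorder)
  then have "j < M \<and> (\<forall>k<M. ?f j \<le> ?f k)" by auto
  from LeastI[of "\<lambda>j. j < M \<and> (\<forall>k<M. ?f j \<le> ?f k)", OF this]
  have "\<forall>k<M. ?f (argmin_idx x s N M i \<omega>) \<le> ?f k"
    by (simp add: argmin_idx_def)
  then show ?thesis
    using assms by (simp add: xhat_min_def Let_def)
qed

text \<open>The complement of the event in \<open>sym_stable_ratio_prob_ge\<close>: Y and S have a
  common law \<mu>, and independence makes their joint law the product of \<mu> with itself.\<close>

lemma (in prob_space) stable_ratio_exceed_prob: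
  assumes \<alpha>: "0 < \<alpha>" "\<alpha> < 1"
    and ind: "indep_var borel Y borel S"
    and Y: "sym_stable \<alpha> (distr M borel Y)" and S: "sym_stable \<alpha> (distr M borel S)"
    and \<delta>: "0 < \<delta>" "\<delta> \<le> 1"
  shows "prob {\<omega> \<in> space M. \<delta> * \<bar>S \<omega>\<bar> < \<bar>Y \<omega>\<bar>} \<le> 1 / (1 + \<delta> powr (\<alpha> / (1 - \<alpha>)))"
proof -
  have [measurable]: "random_variable borel Y" "random_variable borel S"
    using ind by (auto dest: indep_var_rv1 indep_var_rv2)
  define \<mu> where "\<mu> = distr M borel S"
  define t where "t = \<delta> powr (\<alpha> / (1 - \<alpha>))"
  have \<mu>: "real_distribution \<mu>" "sym_stable \<alpha> \<mu>"
    unfolding \<mu>_def using S by auto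
  have "distr M borel Y = \<mu>"
    by (rule sym_stable_unique[OF _ \<mu>(1) Y \<mu>(2)]) auto
  with ind have joint: "distr M (borel \<Otimes>\<^sub>M borel) (\<lambda>\<omega>. (Y \<omega>, S \<omega>)) = \<mu> \<Otimes>\<^sub>M \<mu>"
    unfolding indep_var_distribution_eq \<mu>_def by simp
  let ?A = "{p :: real \<times> real. \<bar>fst p\<bar> \<le> \<delta> * \<bar>snd p\<bar>}"
  let ?C = "{\<omega> \<in> space M. \<bar>Y \<omega>\<bar> \<le> \<delta> * \<bar>S \<omega>\<bar>}"
  have A: "?A \<in> sets (borel \<Otimes>\<^sub>M borel)"
  proof -
    have "{p \<in> space (borel \<Otimes>\<^sub>M borel). \<bar>fst p\<bar> \<le> \<delta> * \<bar>snd p\<bar>} \<in> sets (borel \<Otimes>\<^sub>M borel)"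
      by measurable
    then show ?thesis by (simp add: space_pair_measure)
  qed
  have "ennreal (t / (1 + t)) \<le> emeasure (\<mu> \<Otimes>\<^sub>M \<mu>) ?A"
    unfolding t_def by (rule sym_stable_ratio_prob_ge[OF \<alpha> \<mu> \<delta>])
  also have "\<dots> = emeasure M ((\<lambda>\<omega>. (Y \<omega>, S \<omega>)) -` ?A \<inter> space M)"
    unfolding joint[symmetric] using A by (intro emeasure_distr) measurable
  also have "(\<lambda>\<omega>. (Y \<omega>, S \<omega>)) -` ?A \<inter> space M = ?C" by auto
  finally have "t / (1 + t) \<le> prob ?C"
    by (simp add: emeasure_eq_measure t_def)
  moreover have "prob (space M - ?C) = 1 - prob ?C"
    by (rule prob_compl) measurable
  moreover have "space M - ?C = {\<omega> \<in> space M. \<delta> * \<bar>S \<omega>\<bar> < \<bar>Y \<omega>\<bar>}"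
    by auto
  moreover have "1 - t / (1 + t) = 1 / (1 + t)"
  proof -
    have "0 < 1 + t" by (simp add: t_def add_pos_nonneg)
    then show ?thesis by (simp add: field_simps)
  qed
  ultimately show ?thesis by (simp add: t_def)
qed

theorem theorem1:
  fixes P :: "'a measure" and x :: "nat \<Rightarrow> real" and s :: "nat \<Rightarrow> nat \<Rightarrow> 'a \<Rightarrow> real"
    and N M :: nat and \<alpha> \<epsilon> \<theta> \<psi> :: real and i :: nat
  assumes "prob_space P"
    and "0 < \<alpha>" and "\<alpha> < 1"
    and "\<exists>k<N. x k \<noteq> 0"
    and "\<And>k j. k < N \<Longrightarrow> j < M \<Longrightarrow> s k j \<in> borel_measurable P"
    and "prob_space.indep_vars P (\<lambda>_. borel) (\<lambda>(k, j). s k j) ({..<N} \<times> {..<M})"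
    and "\<And>k j. k < N \<Longrightarrow> j < M \<Longrightarrow> sym_stable \<alpha> (distr P borel (s k j))"
    and "0 < \<epsilon>"
    and "\<theta> = (\<Sum>k<N. \<bar>x k\<bar> powr \<alpha>) powr (1 / \<alpha>)"
    and "\<psi> = (\<epsilon> / \<theta>) powr (\<alpha> / (1 - \<alpha>))"
    and "\<psi> \<le> 1 / 3"
    and "i < N" and "x i = 0"
  shows "measure P {\<omega> \<in> space P. \<bar>xhat_min x s N M i \<omega>\<bar> > \<epsilon>} \<le> 1 / (1 + \<psi>) ^ M"
\<comment> \<open>For M = 0 the bound is 1. It is split off because intersecting over j and using
  independence below require a nonempty index set.\<close>
proof (cases "M = 0")
  case True
  then show ?thesis
    using prob_space.prob_le_1[OF assms(1)] by simp
next
  case False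
  then have M: "0 < M" by simp
  interpret P: prob_space P by (rule assms(1))
  note ind = assms(6)
  define \<delta> where "\<delta> = \<epsilon> / \<theta>"
  have "0 < (\<Sum>k<N. \<bar>x k\<bar> powr \<alpha>)"
    using assms(4) by (auto intro!: sum_pos2)
  then have \<theta>: "0 < \<theta>" "\<theta> powr \<alpha> = (\<Sum>k<N. \<bar>x k\<bar> powr \<alpha>)"
    using \<open>0 < \<alpha>\<close> by (auto simp: assms(9) powr_powr)
  have \<delta>: "0 < \<delta>" using \<theta> assms(8) by (simp add: \<delta>_def)
  \<comment> \<open>A value \<delta> > 1 would give \<psi> \<ge> 1. The angle inequalities are
    available for \<delta> \<le> 1.\<close>
  have \<delta>1: "\<delta> \<le> 1"
  proof (rule ccontr)
    assume "\<not> \<delta> \<le> 1"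
    then have "1 \<le> \<delta> powr (\<alpha> / (1 - \<alpha>))"
      using assms(2,3) by (intro ge_one_powr_ge_zero) auto
    then show False using assms(10,11) by (simp add: \<delta>_def)
  qed
  define E where "E j = {\<omega> \<in> space P. \<epsilon> * \<bar>s i j \<omega>\<bar> < \<bar>meas x s N j \<omega>\<bar>}" for j
  have meas_P: "meas x s N j \<in> borel_measurable P" if "j < M" for j
    unfolding meas_def[abs_def] using assms(5) that by (intro borel_measurable_sum borel_measurable_times) auto
  have E_sets: "E j \<in> P.events" if "j < M" for j
    unfolding E_def using meas_P[OF that] assms(5)[OF assms(12) that] by measurable
  \<comment> \<open>If the minimum exceeds \<epsilon>, so does every quotient. Division by 0 yields
    0, so a quotient above \<epsilon> > 0 has nonzero denominator and can be multiplied out.\<close>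
  have "{\<omega> \<in> space P. \<bar>xhat_min x s N M i \<omega>\<bar> > \<epsilon>} \<subseteq> (\<Inter>j<M. E j)"
  proof (intro subsetI INT_I)
    fix \<omega> j assume \<omega>: "\<omega> \<in> {\<omega> \<in> space P. \<bar>xhat_min x s N M i \<omega>\<bar> > \<epsilon>}" and j: "j \<in> {..<M}"
    then have less: "\<epsilon> < \<bar>meas x s N j \<omega> / s i j \<omega>\<bar>"
      using abs_xhat_min_le[of j M x s N i \<omega>] by auto
    with \<open>0 < \<epsilon>\<close> have "s i j \<omega> \<noteq> 0" by auto
    with less \<omega> show "\<omega> \<in> E j" by (simp add: E_def field_simps)
  qed
  then have "measure P {\<omega> \<in> space P. \<bar>xhat_min x s N M i \<omega>\<bar> > \<epsilon>} \<le> P.prob (\<Inter>j<M. E j)"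
    using M E_sets by (intro P.finite_measure_mono sets.finite_INT) auto
  also have "\<dots> = (\<Prod>j<M. P.prob (E j))"
  proof -
    \<comment> \<open>Each event \<open>E j\<close> depends only on the variables with second index
      j. These blocks are disjoint, so the events are independent.\<close>
    let ?K = "\<lambda>j. {..<N} \<times> {j}"
    let ?X = "\<lambda>j \<omega>. restrict (\<lambda>p. (case p of (k, j) \<Rightarrow> s k j) \<omega>) (?K j)"
    let ?A = "\<lambda>j. {f \<in> space (PiM (?K j) (\<lambda>_. borel)). \<epsilon> * \<bar>f (i, j)\<bar> < \<bar>\<Sum>k<N. x k * f (k, j)\<bar>}"
    have "P.indep_vars (\<lambda>j. PiM (?K j) (\<lambda>_. borel)) ?X {..<M}"
      by (rule P.indep_vars_restrict[OF ind]) (auto simp: disjoint_family_on_def)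
    moreover have "?A j \<in> sets (PiM (?K j) (\<lambda>_. borel))" for j
    proof -
      have [measurable]: "(\<lambda>f. f (k, j)) \<in> borel_measurable (PiM (?K j) (\<lambda>_. borel))" if "k < N" for k
        using that by (intro measurable_component_singleton) auto
      have [measurable]: "(\<lambda>f. \<Sum>k<N. x k * f (k, j)) \<in> borel_measurable (PiM (?K j) (\<lambda>_. borel))"
        by (intro borel_measurable_sum borel_measurable_times) auto
      show ?thesis using \<open>i < N\<close> by measurable
    qed
    ultimately have prod: "P.prob (\<Inter>j<M. ?X j -` ?A j \<inter> space P) = (\<Prod>j<M. P.prob (?X j -` ?A j \<inter> space P))"
      using M by (intro P.indep_varsD_finite) auto
    have E_eq: "?X j -` ?A j \<inter> space P = E j" for j
      using \<open>i < N\<close> by (auto simp: E_def meas_def space_PiM)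
    show ?thesis using prod unfolding E_eq .
  qed
  also have "\<dots> \<le> (\<Prod>j<M. 1 / (1 + \<psi>))"
  proof (rule prod_mono)
    fix j assume "j \<in> {..<M}"
    then have j: "j < M" by simp
    \<comment> \<open>Because \<open>x i = 0\<close>, row i can be left out of the sum, so
      \<open>Y\<close> is independent of \<open>s i j\<close>. Dividing the coefficients by \<theta>
      gives \<open>Y\<close> unit scale.\<close>
    define I where "I = ({..<N} - {i}) \<times> {j}"
    define Y where "Y \<omega> = (\<Sum>p\<in>I. x (fst p) / \<theta> * (case p of (k, j) \<Rightarrow> s k j) \<omega>)" for \<omega>
    have sumI: "(\<Sum>p\<in>I. f p) = (\<Sum>k\<in>{..<N} - {i}. f (k, j))" for f :: "nat \<times> nat \<Rightarrow> real"
    proof -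
      have "I = (\<lambda>k. (k, j)) ` ({..<N} - {i})" by (auto simp: I_def)
      then show ?thesis by (simp add: sum.reindex inj_on_def)
    qed
    have I: "finite I" "I \<subseteq> {..<N} \<times> {..<M}" "I \<inter> {(i, j)} = {}"
      using j by (auto simp: I_def)
    have "meas x s N j \<omega> = \<theta> * Y \<omega>" for \<omega>
      using \<theta>(1) \<open>i < N\<close> \<open>x i = 0\<close>
      by (simp add: meas_def Y_def sumI sum_distrib_left sum.remove[of "{..<N}" i])
    then have E_eq: "E j = {\<omega> \<in> space P. \<delta> * \<bar>s i j \<omega>\<bar> < \<bar>Y \<omega>\<bar>}"
      using \<theta>(1) by (auto simp: E_def \<delta>_def abs_mult field_simps)
    have "P.indep_var borel Y borel (s i j)"
    proof -
      have "P.indep_var borel ((\<lambda>f. \<Sum>p\<in>I. x (fst p) / \<theta> * f p) \<circ> (\<lambda>\<omega>. restrict (\<lambda>p. (case p of (k, j) \<Rightarrow> s k j) \<omega>) I))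
          borel ((\<lambda>f. f (i, j)) \<circ> (\<lambda>\<omega>. restrict (\<lambda>p. (case p of (k, j) \<Rightarrow> s k j) \<omega>) {(i, j)}))"
        using I j \<open>i < N\<close>
        by (intro P.indep_var_compose[OF P.indep_var_restrict[OF ind]] borel_measurable_sum borel_measurable_times) auto
      then show ?thesis by (simp add: comp_def Y_def[abs_def])
    qed
    moreover have "sym_stable \<alpha> (distr P borel Y)"
      unfolding Y_def
    proof (rule P.sym_stable_linear_combination[OF \<open>0 < \<alpha>\<close> I(1) P.indep_vars_subset[OF ind I(2)]])
      show "sym_stable \<alpha> (distr P borel (case p of (k, j) \<Rightarrow> s k j))" if "p \<in> I" for p
        using that I(2) assms(7) by auto
      have "(\<Sum>k<N. \<bar>x k\<bar> powr \<alpha>) = (\<Sum>k\<in>{..<N} - {i}. \<bar>x k\<bar> powr \<alpha>)"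
        using \<open>i < N\<close> \<open>x i = 0\<close> by (simp add: sum.remove[of "{..<N}" i])
      moreover have "0 < \<theta> powr \<alpha>" using \<theta>(1) by simp
      ultimately show "(\<Sum>p\<in>I. \<bar>x (fst p) / \<theta>\<bar> powr \<alpha>) = 1"
        using \<theta> by (simp add: sumI abs_divide powr_divide flip: sum_divide_distrib)
    qed
    moreover have "sym_stable \<alpha> (distr P borel (s i j))"
      using assms(7) \<open>i < N\<close> j by blast
    ultimately have "P.prob (E j) \<le> 1 / (1 + \<delta> powr (\<alpha> / (1 - \<alpha>)))"
      unfolding E_eq by (rule P.stable_ratio_exceed_prob[OF assms(2,3) _ _ _ \<delta> \<delta>1])
    then show "0 \<le> P.prob (E j) \<and> P.prob (E j) \<le> 1 / (1 + \<psi>)"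
      by (simp add: \<delta>_def assms(10))
  qed
  also have "\<dots> = 1 / (1 + \<psi>) ^ M"
    by (simp add: power_one_over)
  finally show ?thesis .
qed

end
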